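(* Let $n\ge 2$, $\beta\ge 1$, let $\Omega\subset\mathbb{R}^n$ be a $\beta$-John domain, and let $s\in(0,1)$, $1\le q\le\frac{n}{n-s}$, $a\ge 0$ and $b\in\mathbb{R}$ with $b\le\frac{n+a}{q\beta}+s-n$. Then there exists a constant $C>0$, independent of $f$, such that for every $f\in C^\infty(\Omega)$ $$ \inf_{c\in\mathbb{R}}\|f-c\|_{L^q(\Omega,d^a)}\le C\int_\Omega\int_{|x-z|\le d(x)/2}\frac{|f(z)-f(x)|}{|z-x|^{n+s}}\,\delta(x,z)^b\,dz\,dx. $$
   Context: $d(x)=\mathrm{dist}(x,\partial\Omega)$ for $x\in\Omega$; $\delta(x,z)=\min\{d(x),d(z)\}$; $\|g\|_{L^q(\Omega,d^a)}=\left(\int_\Omega |g(y)|^q d(y)^a\,dy\right)^{1/q}$. Both sides of the inequality are allowed to take the value $+\infty$. $\beta$-John domain ($\beta\ge 1$): it is assumed that $0\in\Omega$. A bounded domain $\Omega\subset\mathbb{R}^n$ is a $\beta$-John domain if there exist a family of rectifiable curves $\gamma(t,y)$, $0\le t\le 1$, $y\in\Omega$, and positive constants $\lambda,K,C_0$ such that: (1) $\gamma(0,y)=y$ and $\gamma(1,y)=0$; (2) $d(\gamma(t,y))\ge\lambda t^\beta$; (3) $|\dot\gamma(t,y)|\le K$, where the dot denotes the derivative in $t$; (4) for all $x,y\in\Omega$ and $r\le\frac12 d(x)$, $\ell(\gamma(y)\cap B(x,r))\le C_0 r$, where $\gamma(y)$ denotes the curve $\gamma(\cdot,y)$ joining $y$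 with $0$ and $\ell$ denotes length. *)

theory Defs
  imports "HOL-Analysis.Analysis"
begin

definition bdist :: "'a::metric_space set \<Rightarrow> 'a \<Rightarrow> real" where
  "bdist \<Omega> x = infdist x (frontier \<Omega>)"

definition bdist2 :: "'a::metric_space set \<Rightarrow> 'a \<Rightarrow> 'a \<Rightarrow> real" where
  "bdist2 \<Omega> x z = min (bdist \<Omega> x) (bdist \<Omega> z)"

text \<open>Length of the part of a curve \<open>g\<close> traced over a set \<open>T\<close> of parameters: the supremum of the
  lengths of polygonal approximations over finitely many non-overlapping closed intervals contained
  in \<open>T\<close>. For \<open>T = {0..1}\<close> this is the total variation; for \<open>T\<close> relatively open in \<open>{0..1}\<close> it is the
  sum of the lengths of the arcs over the components of \<open>T\<close>.\<close>

definition curve_length :: "(real \<Rightarrow> 'a::real_normed_vector) \<Rightarrow> real set \<Rightarrow> ennreal" where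
  "curve_length g T =
     (SUP D\<in>{D. D division_of \<Union>D \<and> \<Union>D \<subseteq> T}. \<Sum>k\<in>D. ennreal (norm (g (Sup k) - g (Inf k))))"

definition rectifiable :: "(real \<Rightarrow> 'a::real_normed_vector) \<Rightarrow> bool" where
  "rectifiable g \<longleftrightarrow> continuous_on {0..1} g \<and> curve_length g {0..1} < top"

text \<open>The speed bound \<open>|\<gamma>'| \<le> K\<close> for a rectifiable curve: the derivative exists and is bounded by \<open>K\<close>
  almost everywhere, and the curve is absolutely continuous. Given the bound on the derivative,
  absolute continuity is the same as being \<open>K\<close>-Lipschitz. It cannot be dropped: reparametrising a
  curve by a singular function gives zero derivative almost everywhere.\<close>

definition speed_bounded :: "real \<Rightarrow> (real \<Rightarrow> 'a::real_normed_vector) \<Rightarrow> bool" where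
  "speed_bounded K g \<longleftrightarrow>
     K-lipschitz_on {0..1} g \<and>
     (AE t in lborel. t \<in> {0<..<1} \<longrightarrow> (\<exists>v. (g has_vector_derivative v) (at t) \<and> norm v \<le> K))"

definition john_domain :: "real \<Rightarrow> 'a::euclidean_space set \<Rightarrow> bool" where
  "john_domain \<beta> \<Omega> \<longleftrightarrow>
     open \<Omega> \<and> connected \<Omega> \<and> bounded \<Omega> \<and> 0 \<in> \<Omega> \<and>
     (\<exists>(\<gamma> :: real \<Rightarrow> 'a \<Rightarrow> 'a) l K C\<^sub>0. l > 0 \<and> K > 0 \<and> C\<^sub>0 > 0 \<and>
        (\<forall>y\<in>\<Omega>. rectifiable (\<lambda>t. \<gamma> t y) \<and> (\<forall>t\<in>{0..1}. \<gamma> t y \<in> \<Omega>)) \<and>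
        (\<forall>y\<in>\<Omega>. \<gamma> 0 y = y \<and> \<gamma> 1 y = 0) \<and>
        (\<forall>y\<in>\<Omega>. \<forall>t\<in>{0..1}. bdist \<Omega> (\<gamma> t y) \<ge> l * t powr \<beta>) \<and>
        (\<forall>y\<in>\<Omega>. speed_bounded K (\<lambda>t. \<gamma> t y)) \<and>
        (\<forall>x\<in>\<Omega>. \<forall>y\<in>\<Omega>. \<forall>r. 0 < r \<and> r \<le> bdist \<Omega> x / 2 \<longrightarrow>
           curve_length (\<lambda>t. \<gamma> t y) {t\<in>{0..1}. \<gamma> t y \<in> ball x r} \<le> ennreal (C\<^sub>0 * r)))"

text \<open>Intended for open \<open>S\<close>, where \<open>at x\<close> and \<open>at x within S\<close> agree for \<open>x \<in> S\<close>; values of \<open>f\<close>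
  outside \<open>S\<close> are then irrelevant.\<close>

primrec Ck_on :: "nat \<Rightarrow> 'a::real_normed_vector set \<Rightarrow> ('a \<Rightarrow> 'b::real_normed_vector) \<Rightarrow> bool" where
  "Ck_on 0 S f \<longleftrightarrow> continuous_on S f"
| "Ck_on (Suc k) S f \<longleftrightarrow>
     f differentiable_on S \<and> (\<forall>v. Ck_on k S (\<lambda>x. frechet_derivative f (at x) v))"

definition smooth_on :: "'a::real_normed_vector set \<Rightarrow> ('a \<Rightarrow> 'b::real_normed_vector) \<Rightarrow> bool" where
  "smooth_on S f \<longleftrightarrow> (\<forall>k. Ck_on k S f)"

text \<open>Powers with positive real exponent.\<close>

definition ennreal_powr :: "ennreal \<Rightarrow> real \<Rightarrow> ennreal" where
  "ennreal_powr u p = (if u = top then top else ennreal (enn2real u powr p))"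

definition weighted_norm :: "real \<Rightarrow> real \<Rightarrow> 'a::euclidean_space set \<Rightarrow> ('a \<Rightarrow> real) \<Rightarrow> ennreal" where
  "weighted_norm q a \<Omega> g =
     ennreal_powr (\<integral>\<^sup>+y\<in>\<Omega>. ennreal (\<bar>g y\<bar> powr q * bdist \<Omega> y powr a) \<partial>lborel) (1 / q)"

end

theory Submission
  imports Defs
begin

text \<open>The inequality is reduced to sets and then proved by a density argument along the John curves.
Write \<open>d\<close> for the distance to the boundary, \<open>k\<close> for the kernel on the right-hand side, restricted to
\<open>|x - z| \<le> d x / 2\<close>, and call \<open>P(E)\<close>, the integral of \<open>k\<close> over \<open>E \<times> (\<Omega> - E)\<close>, the crossing energy of
\<open>E\<close>. By the coarea formula the crossing energies of the level sets \<open>{f > t}\<close> integrate over \<open>t\<close> to at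
most the right-hand side, and by the layer-cake formula the \<open>L\<^sup>q\<close> norm of a nonnegative function \<open>g\<close> is
at most a constant times the integral over \<open>t\<close> of \<open>\<mu>{g > t} powr (1/q)\<close>, where \<open>\<mu>\<close> has density
\<open>d powr a\<close>. If \<open>c\<close> is a median of \<open>f\<close> on a fixed ball \<open>B\<^sub>0\<close> around the origin, it is therefore enough to show
\<open>\<mu>(E) powr (1/q) \<le> C P(E)\<close> for every set \<open>E\<close> that fills at most half of \<open>B\<^sub>0\<close>
(\<open>level_set_inequality\<close>), and to apply this to the level sets of \<open>f - c\<close> and of \<open>c - f\<close>.

For such a set, cover \<open>\<Omega>\<close> with bounded overlap by balls \<open>B\<close> of radius \<open>d / 10\<close>. In a ball of which
\<open>E\<close> fills at most half, a relative isoperimetric inequality bounds \<open>\<mu>(E \<inter> B)\<close> by the energy that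
crosses inside \<open>B\<close>; this uses \<open>q \<le> n / (n - s)\<close> (\<open>low_density_piece\<close>). From the centre of a ball that
\<open>E\<close> fills more than half, the John curve leads to the origin, where the density of \<open>E\<close> is at most
one half, so on the way it meets a point \<open>h\<close> of density exactly one half. The energy that crosses in
the ball of radius \<open>d h / 10\<close> around \<open>h\<close> is then at least of order \<open>d h powr (b + n - s)\<close>, while the
original ball lies within a distance of order \<open>d h powr (1/\<beta>)\<close> from \<open>h\<close>, because the curve satisfies
\<open>d \<ge> l t powr \<beta>\<close> and has bounded speed. The part of \<open>\<Omega>\<close> within that distance has \<open>\<mu>\<close>-measure at most of order
\<open>d h powr ((n + a)/\<beta>)\<close>, and the hypothesis on \<open>b\<close> says precisely that the \<open>q\<close>-th root of this is
controlled by the crossing energy (\<open>half_density_piece\<close>). A second cover with bounded overlap, now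
of the set of points of density one half, keeps the sum of these energies below a multiple of \<open>P(E)\<close>.
Since \<open>q \<ge> 1\<close>, the bounds for the pieces add up to one for \<open>E\<close> (\<open>emeasure_UN_le_powr\<close>).

The curves are followed only from the countably many centres of the first cover, so their dependence
on the starting point never has to be integrated, and arguing with sets gives the endpoint
\<open>q = n / (n - s)\<close> together with the other exponents.\<close>

section \<open>Powers, level sets and countable unions\<close>

lemma emeasure_UN_le_nn_integral_count_space:
  assumes "countable I" and A: "\<And>i. i \<in> I \<Longrightarrow> A i \<in> sets M"
  shows "emeasure M (\<Union>i\<in>I. A i) \<le> (\<integral>\<^sup>+i. emeasure M (A i) \<partial>count_space I)"
proof -
  have [measurable]: "(\<Union>i\<in>I. A i) \<in> sets M"
    using assms by (intro sets.countable_UN') auto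
  have ind: "(\<lambda>x. indicator (A i) x :: ennreal) \<in> borel_measurable M" if "i \<in> I" for i
    using A[OF that] by simp
  have "emeasure M (\<Union>i\<in>I. A i) = (\<integral>\<^sup>+x. indicator (\<Union>i\<in>I. A i) x \<partial>M)"
    by simp
  also have "\<dots> \<le> (\<integral>\<^sup>+x. (\<integral>\<^sup>+i. indicator (A i) x \<partial>count_space I) \<partial>M)"
  proof (rule nn_integral_mono)
    fix x
    show "indicator (\<Union>i\<in>I. A i) x \<le> (\<integral>\<^sup>+i. indicator (A i) x \<partial>count_space I)"
    proof (cases "x \<in> (\<Union>i\<in>I. A i)")
      case True
      then obtain i where "i \<in> I" "x \<in> A i" by auto
      then show ?thesis
        using nn_integral_ge_point[of i I "\<lambda>i. indicator (A i) x"] True by simp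
    qed simp
  qed
  also have "\<dots> = (\<integral>\<^sup>+i. emeasure M (A i) \<partial>count_space I)"
    using assms by (subst nn_integral_count_space_nn_integral) (auto intro!: nn_integral_cong ind)
  finally show ?thesis .
qed

lemma powr_le_powr_mult:
  fixes x y q :: real
  assumes "0 \<le> x" "x \<le> y" "1 \<le> q"
  shows "x powr q \<le> y powr (q - 1) * x"
proof (cases "x = 0")
  case False
  then have "x powr q = x powr (q - 1) * x"
    using assms powr_add[of x "q - 1" 1] by simp
  also have "\<dots> \<le> y powr (q - 1) * x"
    using assms by (intro mult_right_mono powr_mono2) auto
  finally show ?thesis .
qed simp

text \<open>If \<open>x \<le> R\<close> then \<open>x powr q \<le> R powr (q - 1) * x\<close>; summing this over the pieces turns the bounds
\<open>(k * p i) powr q\<close> into one for the union. Bounds are only asked where \<open>p i\<close> is finite, which the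
hypothesis on the sum guarantees.\<close>

lemma emeasure_UN_le_powr:
  fixes p :: "'i \<Rightarrow> ennreal"
  assumes "countable I" and A: "\<And>i. i \<in> I \<Longrightarrow> A i \<in> sets M"
    and "1 \<le> q" "0 \<le> k" "0 \<le> R"
    and sum: "(\<integral>\<^sup>+i. p i \<partial>count_space I) \<le> ennreal R"
    and piece: "\<And>i x. i \<in> I \<Longrightarrow> 0 \<le> x \<Longrightarrow> p i = ennreal x \<Longrightarrow> emeasure M (A i) \<le> ennreal ((k * x) powr q)"
  shows "emeasure M (\<Union>i\<in>I. A i) \<le> ennreal ((k * R) powr q)"
proof -
  have "emeasure M (A i) \<le> ennreal (k powr q * R powr (q - 1)) * p i" if i: "i \<in> I" for i
  proof -
    have "p i \<le> ennreal R"
      using nn_integral_ge_point[OF i, of p] sum by (rule order_trans)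
    then obtain x where x: "0 \<le> x" "p i = ennreal x" "x \<le> R"
      using \<open>0 \<le> R\<close> by (cases "p i") (auto simp: top_unique)
    have "(k * x) powr q \<le> k powr q * R powr (q - 1) * x"
      using powr_le_powr_mult[OF x(1,3) \<open>1 \<le> q\<close>] x \<open>0 \<le> k\<close>
      by (simp add: powr_mult mult.assoc mult_left_mono)
    then have "ennreal ((k * x) powr q) \<le> ennreal (k powr q * R powr (q - 1)) * p i"
      using x by (simp add: ennreal_mult[symmetric] ennreal_leI)
    then show ?thesis
      using piece[OF i x(1,2)] by (rule order_trans[rotated])
  qed
  then have "(\<integral>\<^sup>+i. emeasure M (A i) \<partial>count_space I) \<le> (\<integral>\<^sup>+i. ennreal (k powr q * R powr (q - 1)) * p i \<partial>count_space I)"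
    by (intro nn_integral_mono) auto
  also have "\<dots> = ennreal (k powr q * R powr (q - 1)) * (\<integral>\<^sup>+i. p i \<partial>count_space I)"
    by (rule nn_integral_cmult) simp
  also have "\<dots> \<le> ennreal (k powr q * R powr (q - 1)) * ennreal R"
    by (intro mult_left_mono sum) simp
  also have "\<dots> = ennreal ((k * R) powr q)"
  proof -
    have "R powr (q - 1) * R = R powr q"
      using powr_add[of R "q - 1" 1] \<open>0 \<le> R\<close> by (cases "R = 0") auto
    then show ?thesis
      using assms by (simp add: ennreal_mult[symmetric] powr_mult mult.assoc)
  qed
  finally show ?thesis
    using emeasure_UN_le_nn_integral_count_space[OF assms(1,2)] by (rule order_trans[rotated])
qed

lemma nn_integral_powr_diff_one:
  assumes "1 \<le> q" "0 \<le> (y::real)"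
  shows "(\<integral>\<^sup>+t. ennreal (q * t powr (q - 1)) * indicator {0<..<y} t \<partial>lborel) = ennreal (y powr q)"
proof -
  have *: "((\<lambda>t. q * t powr (q - 1) * indicator {0<..<y} t) has_integral (y powr q)) UNIV"
  proof -
    have "((\<lambda>t. q * t powr (q - 1)) has_integral (q * (y powr (q - 1 + 1) / (q - 1 + 1)))) {0..y}"
      using assms by (intro has_integral_mult_right has_integral_powr_from_0) auto
    then have "((\<lambda>t. q * t powr (q - 1)) has_integral (y powr q)) {0<..<y}"
      using assms by (simp add: has_integral_Icc_iff_Ioo)
    then have "((\<lambda>t. if t \<in> {0<..<y} then q * t powr (q - 1) else 0) has_integral (y powr q)) UNIV"
      by (subst has_integral_restrict_UNIV)
    then show ?thesis
      by (rule has_integral_eq[rotated]) (auto simp: indicator_def)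
  qed
  have "(\<integral>\<^sup>+t. ennreal (q * t powr (q - 1)) * indicator {0<..<y} t \<partial>lborel)
     = (\<integral>\<^sup>+t. ennreal (q * t powr (q - 1) * indicator {0<..<y} t) \<partial>lborel)"
    by (intro nn_integral_cong) (auto simp: indicator_def)
  also have "\<dots> = ennreal (y powr q)"
    using assms by (intro nn_integral_has_integral_lborel[OF _ _ *]) auto
  finally show ?thesis .
qed

text \<open>With \<open>\<phi> t = measure M {g > t} powr (1/q)\<close>, the layer-cake formula writes the left-hand side as the integral
of \<open>q * t powr (q - 1) * \<phi> t powr q = q * (t * \<phi> t) powr (q - 1) * \<phi> t\<close>. As \<open>\<phi>\<close> is decreasing,
\<open>t * \<phi> t\<close> is at most the integral of \<open>\<phi>\<close>, hence at most \<open>I\<close>.\<close>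

lemma nn_integral_powr_le_level_sets:
  fixes g :: "'a \<Rightarrow> real"
  assumes "finite_measure M" and g[measurable]: "g \<in> borel_measurable M" and "\<And>x. 0 \<le> g x"
    and "1 \<le> q" "0 \<le> I"
    and lev: "(\<integral>\<^sup>+t. ennreal (measure M {x \<in> space M. t < g x} powr (1 / q)) * indicator {0<..} t \<partial>lborel) \<le> ennreal I"
  shows "(\<integral>\<^sup>+x. ennreal (g x powr q) \<partial>M) \<le> ennreal (q * I powr q)"
proof -
  interpret finite_measure M by fact
  interpret pair_sigma_finite lborel M ..
  define m where "m t = measure M {x \<in> space M. t < g x}" for t
  define \<phi> where "\<phi> t = m t powr (1 / q)" for t
  have \<phi>_anti: "\<phi> t \<le> \<phi> u" if "u \<le> t" for u t
    unfolding \<phi>_def m_def using that \<open>1 \<le> q\<close>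
    by (intro powr_mono2 finite_measure_mono) auto
  have \<phi>_nn: "0 \<le> \<phi> t" for t by (simp add: \<phi>_def)
  have [measurable]: "m \<in> borel_measurable borel" unfolding m_def by measurable
  have [measurable]: "\<phi> \<in> borel_measurable borel" unfolding \<phi>_def by measurable
  have m_eq: "m t = \<phi> t powr q" for t
    using \<open>1 \<le> q\<close> by (simp add: \<phi>_def powr_powr m_def)
  have t\<phi>: "t * \<phi> t \<le> I" if "0 < t" for t
  proof -
    have "ennreal (t * \<phi> t) = (\<integral>\<^sup>+u. ennreal (\<phi> t) * indicator {0<..t} u \<partial>lborel)"
      using that by (simp add: nn_integral_cmult_indicator ennreal_mult[symmetric] \<phi>_nn mult.commute)
    also have "\<dots> \<le> (\<integral>\<^sup>+u. ennreal (\<phi> u) * indicator {0<..} u \<partial>lborel)"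
      by (intro nn_integral_mono) (auto simp: indicator_def ennreal_leI \<phi>_anti)
    also have "\<dots> \<le> ennreal I" using lev by (simp add: \<phi>_def m_def)
    finally show ?thesis using \<open>0 \<le> I\<close> by (simp add: ennreal_le_iff)
  qed
  have "(\<integral>\<^sup>+x. ennreal (g x powr q) \<partial>M)
      = (\<integral>\<^sup>+x. (\<integral>\<^sup>+t. ennreal (q * t powr (q - 1)) * indicator {0<..<g x} t \<partial>lborel) \<partial>M)"
    using assms by (simp add: nn_integral_powr_diff_one)
  also have "\<dots> = (\<integral>\<^sup>+x. (\<integral>\<^sup>+t. ennreal (q * t powr (q - 1)) * (if 0 < t \<and> t < g x then 1 else 0) \<partial>lborel) \<partial>M)"
    by (intro nn_integral_cong) (auto simp: indicator_def)
  also have "\<dots> = (\<integral>\<^sup>+t. (\<integral>\<^sup>+x. ennreal (q * t powr (q - 1)) * (if 0 < t \<and> t < g x then 1 else 0) \<partial>M) \<partial>lborel)"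
    by (rule Fubini') measurable
  also have "\<dots> = (\<integral>\<^sup>+t. ennreal (q * t powr (q - 1) * m t) * indicator {0<..} t \<partial>lborel)"
  proof (rule nn_integral_cong)
    fix t :: real
    have "(\<integral>\<^sup>+x. ennreal (q * t powr (q - 1)) * (if 0 < t \<and> t < g x then 1 else 0) \<partial>M)
      = (\<integral>\<^sup>+x. (ennreal (q * t powr (q - 1)) * indicator {0<..} t) * indicator {x \<in> space M. t < g x} x \<partial>M)"
      by (intro nn_integral_cong) (auto simp: indicator_def)
    also have "\<dots> = ennreal (q * t powr (q - 1)) * indicator {0<..} t * emeasure M {x \<in> space M. t < g x}"
      by (subst nn_integral_cmult_indicator) auto
    also have "\<dots> = ennreal (q * t powr (q - 1) * m t) * indicator {0<..} t"
      using \<open>1 \<le> q\<close> by (simp add: m_def emeasure_eq_measure ennreal_mult mult_ac)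
    finally show "(\<integral>\<^sup>+x. ennreal (q * t powr (q - 1)) * (if 0 < t \<and> t < g x then 1 else 0) \<partial>M)
      = ennreal (q * t powr (q - 1) * m t) * indicator {0<..} t" .
  qed
  also have "\<dots> \<le> (\<integral>\<^sup>+t. ennreal (q * I powr (q - 1)) * (ennreal (\<phi> t) * indicator {0<..} t) \<partial>lborel)"
  proof (rule nn_integral_mono)
    fix t :: real
    have "q * t powr (q - 1) * m t \<le> q * I powr (q - 1) * \<phi> t" if "0 < t"
    proof -
      have "t * (t powr (q - 1) * m t) = (t * \<phi> t) powr q"
        using that \<phi>_nn powr_add[of t 1 "q - 1"] by (simp add: m_eq powr_mult)
      also have "\<dots> \<le> I powr (q - 1) * (t * \<phi> t)"
        using that \<phi>_nn t\<phi> \<open>1 \<le> q\<close> by (intro powr_le_powr_mult) auto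
      finally have "t powr (q - 1) * m t \<le> I powr (q - 1) * \<phi> t"
        using that by (metis mult.left_commute mult_le_cancel_left_pos)
      then show ?thesis using \<open>1 \<le> q\<close> by (simp add: mult.assoc mult_left_mono)
    qed
    then show "ennreal (q * t powr (q - 1) * m t) * indicator {0<..} t
      \<le> ennreal (q * I powr (q - 1)) * (ennreal (\<phi> t) * indicator {0<..} t)"
      using \<open>1 \<le> q\<close> by (auto simp: indicator_def ennreal_mult[symmetric] \<phi>_nn intro!: ennreal_leI)
  qed
  also have "\<dots> = ennreal (q * I powr (q - 1)) * (\<integral>\<^sup>+t. ennreal (\<phi> t) * indicator {0<..} t \<partial>lborel)"
    by (rule nn_integral_cmult) measurable
  also have "\<dots> \<le> ennreal (q * I powr (q - 1)) * ennreal I"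
    using lev by (intro mult_left_mono) (auto simp: \<phi>_def m_def)
  also have "\<dots> = ennreal (q * I powr q)"
  proof -
    have "I powr (q - 1) * I = I powr q"
      using powr_add[of I "q - 1" 1] \<open>0 \<le> I\<close> by (cases "I = 0") auto
    then show ?thesis
      using assms by (simp add: ennreal_mult[symmetric] mult.assoc)
  qed
  finally show ?thesis .
qed

lemma powr_comparable:
  fixes u v b :: real
  assumes "0 < u" "u / 2 \<le> v" "v \<le> 2 * u"
  shows "2 powr (- \<bar>b\<bar>) * u powr b \<le> v powr b"
proof (cases "0 \<le> b")
  case True
  then have "2 powr (- \<bar>b\<bar>) * u powr b = (u / 2) powr b"
    using assms by (simp add: powr_divide powr_minus_divide)
  also have "\<dots> \<le> v powr b" using True assms by (intro powr_mono2) auto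
  finally show ?thesis .
next
  case False
  then have "2 powr (- \<bar>b\<bar>) * u powr b = (2 * u) powr b"
    using assms by (simp add: powr_mult)
  also have "\<dots> \<le> v powr b" using False assms by (intro powr_mono2') auto
  finally show ?thesis .
qed

lemma powr_le_scale:
  fixes x D e1 e2 :: real
  assumes "0 < x" "x \<le> D" "e1 \<le> e2"
  shows "x powr e2 \<le> D powr (e2 - e1) * x powr e1"
proof -
  have "x powr e2 = x powr (e2 - e1) * x powr e1"
    using powr_add[of x "e2 - e1" e1] by simp
  also have "\<dots> \<le> D powr (e2 - e1) * x powr e1"
    using assms by (intro mult_right_mono powr_mono2) auto
  finally show ?thesis .
qed

lemma ennreal_powr_le:
  assumes "u \<le> ennreal r" "0 \<le> r" "0 \<le> p"
  shows "ennreal_powr u p \<le> ennreal (r powr p)"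
proof -
  obtain x where "0 \<le> x" "u = ennreal x" using assms by (cases u) (auto simp: top_unique)
  then show ?thesis
    using assms by (auto simp: ennreal_powr_def intro!: ennreal_leI powr_mono2)
qed

section \<open>Crossing energies and the isoperimetric inequality in a ball\<close>

text \<open>The nonlocal perimeter of a set, split into its two sides: the interaction energy of \<open>A\<close> and \<open>B\<close> under \<open>k\<close>.\<close>

definition crossing :: "('a::euclidean_space \<Rightarrow> 'a \<Rightarrow> ennreal) \<Rightarrow> 'a set \<Rightarrow> 'a set \<Rightarrow> ennreal" where
  "crossing k A B = (\<integral>\<^sup>+x\<in>A. (\<integral>\<^sup>+z\<in>B. k x z \<partial>lborel) \<partial>lborel)"

lemma crossing_mono:
  assumes "A \<subseteq> A'" "B \<subseteq> B'" "\<And>x z. x \<in> A \<Longrightarrow> z \<in> B \<Longrightarrow> k x z \<le> k' x z"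
  shows "crossing k A B \<le> crossing k' A' B'"
  unfolding crossing_def using assms
  by (intro nn_integral_mono) (auto simp: indicator_def intro!: nn_integral_mono)

lemma crossing_cmult:
  fixes k :: "'a::euclidean_space \<Rightarrow> 'a \<Rightarrow> ennreal"
  assumes k[measurable]: "case_prod k \<in> borel_measurable (borel \<Otimes>\<^sub>M borel)"
    and [measurable]: "A \<in> sets borel" "B \<in> sets borel"
  shows "crossing (\<lambda>x z. w * k x z) A B = w * crossing k A B"
proof -
  have "crossing (\<lambda>x z. w * k x z) A B = (\<integral>\<^sup>+x. w * ((\<integral>\<^sup>+z\<in>B. k x z \<partial>lborel) * indicator A x) \<partial>lborel)"
    unfolding crossing_def by (simp add: nn_integral_cmult mult.assoc)
  also have "\<dots> = w * crossing k A B"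
    unfolding crossing_def by (subst nn_integral_cmult) auto
  finally show ?thesis .
qed

lemma Int_ball_fmeasurable:
  fixes x :: "'a::euclidean_space"
  assumes "E \<in> sets borel"
  shows "E \<inter> ball x r \<in> fmeasurable lborel"
proof (rule fmeasurableI)
  have "emeasure lborel (E \<inter> ball x r) \<le> emeasure lborel (ball x r)"
    by (intro emeasure_mono) auto
  also have "\<dots> < \<infinity>"
    using emeasure_lborel_ball_finite[of x r] by simp
  finally show "emeasure lborel (E \<inter> ball x r) < \<infinity>" .
qed (use assms in auto)

lemmas ball_fmeasurable = Int_ball_fmeasurable[of UNIV, simplified]

text \<open>Moving from \<open>y\<close> towards \<open>x\<close> by the fraction \<open>r / (2 * R)\<close> of the way gives a centre that is at distance
at most \<open>r / 2\<close> from \<open>y\<close> and at most \<open>R - r / 2\<close> from \<open>x\<close>. So a ball of radius \<open>R\<close> contains a fixed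
proportion of each ball of radius \<open>r \<le> 2 * R\<close> centred in it.\<close>

lemma exists_ball_in_Int_balls:
  fixes x y :: "'a::euclidean_space"
  assumes "y \<in> ball x R" "0 < r" "r \<le> 2 * R"
  obtains p where "ball p (r / 2) \<subseteq> ball x R \<inter> ball y r"
proof -
  define \<theta> where "\<theta> = r / (2 * R)"
  have R: "0 < R" using assms by auto
  have \<theta>: "0 \<le> \<theta>" "\<theta> \<le> 1" "\<theta> * R = r / 2" using assms R by (auto simp: \<theta>_def field_simps)
  define p where "p = y + \<theta> *\<^sub>R (x - y)"
  have "p - y = \<theta> *\<^sub>R (x - y)" "p - x = (1 - \<theta>) *\<^sub>R (y - x)"
    by (simp_all add: p_def algebra_simps)
  then have "dist p y = \<theta> * dist x y" "dist p x = (1 - \<theta>) * dist x y"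
    using \<theta> by (simp_all add: dist_norm norm_minus_commute)
  moreover have "\<theta> * dist x y \<le> \<theta> * R" "(1 - \<theta>) * dist x y \<le> (1 - \<theta>) * R"
    using assms \<theta> by (auto intro!: mult_left_mono)
  ultimately have "dist p y \<le> r / 2" "dist p x \<le> R - r / 2"
    using \<theta> by (auto simp: algebra_simps)
  then have "dist x z < R \<and> dist y z < r" if "dist p z < r / 2" for z
    using that dist_triangle[of x z p] dist_triangle[of y z p] by (simp add: dist_commute)
  then show thesis by (intro that[of p]) auto
qed

text \<open>Let \<open>m\<close> be the volume of \<open>E\<close> in the ball, and choose \<open>r\<close> so that a ball of radius \<open>r / 2\<close> has volume
\<open>2 * m\<close>. Around each point \<open>y\<close> of \<open>E\<close> there is then a volume of at least \<open>m\<close> in the ball, outside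
\<open>E\<close> and within distance \<open>r\<close> of \<open>y\<close>, on which the kernel is at least \<open>r powr (-(n + s))\<close>. Integrating over \<open>E\<close>
gives \<open>m * m * r powr (-(n + s))\<close>, a multiple of \<open>m powr (1 - s/n)\<close>.\<close>

lemma isoperimetric_ball:
  fixes s :: real
  assumes "0 < s"
  obtains c where "0 < c"
    "\<And>(x::'a::euclidean_space) R E. 0 < R \<Longrightarrow> E \<in> sets borel \<Longrightarrow>
       2 * measure lborel (E \<inter> ball x R) \<le> measure lborel (ball x R) \<Longrightarrow>
       ennreal (c * measure lborel (E \<inter> ball x R) powr (1 - s / DIM('a)))
         \<le> crossing (\<lambda>y z. ennreal (1 / norm (z - y) powr (DIM('a) + s))) (E \<inter> ball x R) (ball x R - E)"
proof -
  define n where "n = real DIM('a)"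
  have n: "0 < n" by (simp add: n_def)
  define \<omega> where "\<omega> = measure lborel (ball (0::'a) 1)"
  have \<omega>: "0 < \<omega>" unfolding \<omega>_def by (rule content_ball_pos) simp
  have vol: "measure lborel (ball p r) = r powr n * \<omega>" if "0 < r" for p :: 'a and r
    using that by (simp add: \<omega>_def n_def content_ball_conv_unit_ball[of r p] powr_realpow)
  \<comment> \<open>\<open>\<kappa>\<close> is chosen so that balls of radius \<open>\<kappa> * m powr (1/n) / 2\<close> have volume \<open>2 * m\<close>.\<close>
  define \<kappa> where "\<kappa> = 2 * (2 / \<omega>) powr (1 / n)"
  have \<kappa>: "0 < \<kappa>" using \<omega> by (simp add: \<kappa>_def)
  define c where "c = \<kappa> powr (- (n + s))"
  have "ennreal (c * measure lborel (E \<inter> ball x R) powr (1 - s / n))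
         \<le> crossing (\<lambda>y z. ennreal (1 / norm (z - y) powr (n + s))) (E \<inter> ball x R) (ball x R - E)"
    if R: "0 < R" and E: "E \<in> sets borel" and half: "2 * measure lborel (E \<inter> ball x R) \<le> measure lborel (ball x R)"
    for x :: 'a and R and E
  proof (cases "measure lborel (E \<inter> ball x R) = 0")
    case False
    have [measurable]: "E \<in> sets borel" by fact
    define m where "m = measure lborel (E \<inter> ball x R)"
    have m: "0 < m" using False by (simp add: m_def zero_less_measure_iff)
    define r where "r = \<kappa> * m powr (1 / n)"
    have r: "0 < r" using \<kappa> m by (simp add: r_def)
    have rn: "(r / 2) powr n * \<omega> = 2 * m"
    proof -
      have "r / 2 = (2 / \<omega>) powr (1 / n) * m powr (1 / n)" by (simp add: r_def \<kappa>_def)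
      then have "(r / 2) powr n = (2 / \<omega>) * m"
        using n m \<omega> by (simp add: powr_mult powr_powr)
      then show ?thesis using \<omega> by simp
    qed
    have "(r / 2) powr n * \<omega> \<le> R powr n * \<omega>"
      using half R by (simp add: rn vol m_def)
    then have "(r / 2) powr n \<le> R powr n" using \<omega> by simp
    then have "r / 2 \<le> R" using n r R by (meson not_le powr_less_mono2 half_gt_zero less_imp_le)
    then have r2R: "r \<le> 2 * R" by simp
    have inner: "ennreal (m * r powr (- (n + s))) \<le> (\<integral>\<^sup>+z\<in>ball x R - E. ennreal (1 / norm (z - y) powr (n + s)) \<partial>lborel)"
      if y: "y \<in> E \<inter> ball x R" for y
    proof -
      obtain p where p: "ball p (r / 2) \<subseteq> ball x R \<inter> ball y r"
        using exists_ball_in_Int_balls[of y x R r] y r r2R by auto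
      define Z where "Z = ball p (r / 2) - E"
      have fin: "ball p (r / 2) \<in> fmeasurable lborel" "E \<inter> ball x R \<in> fmeasurable lborel"
        by (auto intro: Int_ball_fmeasurable ball_fmeasurable)
      have "measure lborel (ball p (r / 2)) = 2 * m" using vol[of "r / 2" p] r rn by simp
      moreover have "measure lborel (ball p (r / 2) \<inter> E) \<le> m"
        unfolding m_def using p fin by (intro measure_mono_fmeasurable) auto
      moreover have "measure lborel Z = measure lborel (ball p (r / 2)) - measure lborel (ball p (r / 2) \<inter> E)"
        unfolding Z_def using fin E by (subst measure_Diff[symmetric]) (auto simp: Diff_Int emeasure_bounded_finite fmeasurable_def less_top)
      ultimately have "m \<le> measure lborel Z" by simp
      moreover have "emeasure lborel Z = ennreal (measure lborel Z)"

        by (rule emeasure_eq_measure2, rule fmeasurableI2[OF fin(1)]) (use E in \<open>auto simp: Z_def\<close>)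
      ultimately have mZ: "ennreal m \<le> emeasure lborel Z" by (simp add: ennreal_leI)
      have "ennreal (m * r powr (- (n + s))) = ennreal (r powr (- (n + s))) * ennreal m"
        using m by (simp add: ennreal_mult[symmetric] mult.commute)
      also have "\<dots> \<le> ennreal (r powr (- (n + s))) * emeasure lborel Z"
        by (intro mult_left_mono mZ) simp
      also have "\<dots> = (\<integral>\<^sup>+z. ennreal (r powr (- (n + s))) * indicator Z z \<partial>lborel)"
        using E by (subst nn_integral_cmult_indicator) (auto simp: Z_def)
      also have "\<dots> \<le> (\<integral>\<^sup>+z\<in>ball x R - E. ennreal (1 / norm (z - y) powr (n + s)) \<partial>lborel)"
      proof (intro nn_integral_mono)
        fix z
        have "r powr (- (n + s)) \<le> 1 / norm (z - y) powr (n + s)" if "z \<in> Z"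
        proof -
          have "norm (z - y) < r" "z \<noteq> y" using that p y by (auto simp: Z_def dist_norm norm_minus_commute)
          then have "norm (z - y) powr (n + s) \<le> r powr (n + s)" "0 < norm (z - y) powr (n + s)"
            using n \<open>0 < s\<close> by (auto intro!: powr_mono2)
          then show ?thesis
            unfolding powr_minus_divide by (intro divide_left_mono mult_pos_pos) (use r in auto)
        qed
        then show "ennreal (r powr (- (n + s))) * indicator Z z
          \<le> ennreal (1 / norm (z - y) powr (n + s)) * indicator (ball x R - E) z"
          using p by (auto simp: indicator_def Z_def ennreal_leI)
      qed
      finally show ?thesis .
    qed
    have "ennreal (c * m powr (1 - s / n)) = ennreal (m * r powr (- (n + s))) * ennreal m"
    proof -
      have "r powr (- (n + s)) = c * m powr (- (1 + s / n))"
        using \<kappa> m n by (simp add: r_def c_def powr_mult powr_powr add_divide_distrib diff_divide_distrib)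
      moreover have "m powr (1 - s / n) = m powr 1 * m powr (- (1 + s / n)) * m powr 1"
        unfolding powr_add[symmetric] by simp
      ultimately have "c * m powr (1 - s / n) = (m * r powr (- (n + s))) * m"
        using m by simp
      then show ?thesis using m by (simp add: ennreal_mult[symmetric] del: powr_minus)
    qed
    also have "ennreal m = emeasure lborel (E \<inter> ball x R)"
      unfolding m_def by (rule emeasure_eq_measure2[symmetric]) (rule Int_ball_fmeasurable[OF E])
    also have "ennreal (m * r powr (- (n + s))) * \<dots> = (\<integral>\<^sup>+y. ennreal (m * r powr (- (n + s))) * indicator (E \<inter> ball x R) y \<partial>lborel)"
      by (subst nn_integral_cmult_indicator) auto
    also have "\<dots> \<le> crossing (\<lambda>y z. ennreal (1 / norm (z - y) powr (n + s))) (E \<inter> ball x R) (ball x R - E)"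
      unfolding crossing_def using inner by (intro nn_integral_mono) (auto simp: indicator_def)
    finally show ?thesis by (simp add: m_def)
  qed simp
  moreover have "0 < c" using \<kappa> by (simp add: c_def)
  ultimately show thesis using that[of c] by (simp add: n_def)
qed

section \<open>Covers by balls of variable radius\<close>

text \<open>For a 1-Lipschitz radius, the ball at \<open>y\<close> lies in the ball at \<open>x\<close> enlarged by \<open>2 * dist x y\<close>, so the two
measures differ at most by the volume of a thin shell.\<close>

lemma continuous_on_measure_Int_ball:
  fixes r :: "'a::euclidean_space \<Rightarrow> real"
  assumes E: "E \<in> sets borel" and lip: "\<And>x y. \<bar>r x - r y\<bar> \<le> dist x y" and nn: "\<And>x. 0 \<le> r x"
  shows "continuous_on S (\<lambda>x. measure lborel (E \<inter> ball x (r x)))"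
proof -
  define n where "n = DIM('a)"
  define \<omega> where "\<omega> = measure lborel (ball (0::'a) 1)"
  define h where "h x = measure lborel (E \<inter> ball x (r x))" for x
  have vol: "measure lborel (ball p \<rho>) = \<rho> ^ n * \<omega>" if "0 \<le> \<rho>" for p :: 'a and \<rho>
    using that by (simp add: \<omega>_def n_def content_ball_conv_unit_ball[of \<rho> p])
  have step: "h y \<le> h x + ((r x + 2 * dist x y) ^ n * \<omega> - r x ^ n * \<omega>)" for x y
  proof -
    let ?A = "ball x (r x + 2 * dist x y)"
    have fin: "E \<inter> ball x (r x) \<in> fmeasurable lborel" for x
      using E by (rule Int_ball_fmeasurable)
    note fin2 = ball_fmeasurable
    have "z \<in> ?A" if "z \<in> ball y (r y)" for z
      using that lip[of y x] dist_triangle[of x z y] by (simp add: dist_commute)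
    then have "E \<inter> ball y (r y) \<subseteq> (E \<inter> ball x (r x)) \<union> (?A - ball x (r x))" by auto
    then have "h y \<le> measure lborel ((E \<inter> ball x (r x)) \<union> (?A - ball x (r x)))"
      unfolding h_def using fin E by (intro measure_mono_fmeasurable fmeasurable.Un fmeasurable.Diff fin2) auto
    also have "\<dots> \<le> h x + measure lborel (?A - ball x (r x))"
      unfolding h_def using E by (intro measure_Un_le) auto
    also have "measure lborel (?A - ball x (r x)) = measure lborel ?A - measure lborel (ball x (r x))"
      by (intro measurable_measure_Diff) (auto intro!: subset_ball ball_fmeasurable)
    also have "\<dots> = (r x + 2 * dist x y) ^ n * \<omega> - r x ^ n * \<omega>"
      using nn[of x] by (simp add: vol)
    finally show ?thesis by simp
  qed
  have r_cont: "(r \<longlongrightarrow> r x) (at x within S)" for x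
  proof -
    have "continuous_on UNIV r"
      using lip by (intro lipschitz_on_continuous_on[of 1] lipschitz_onI) (auto simp: dist_real_def)
    then show ?thesis
      by (meson UNIV_I continuous_on_def tendsto_within_subset subset_UNIV)
  qed
  show ?thesis
    unfolding continuous_on_def
  proof (intro ballI)
    fix x assume "x \<in> S"
    define u where "u y = (r x + 2 * dist x y) ^ n * \<omega> - r x ^ n * \<omega>" for y
    define v where "v y = (r y + 2 * dist y x) ^ n * \<omega> - r y ^ n * \<omega>" for y
    have "((\<lambda>y. h x + u y) \<longlongrightarrow> h x + ((r x + 2 * dist x x) ^ n * \<omega> - r x ^ n * \<omega>)) (at x within S)"
      unfolding u_def by (intro tendsto_intros)
    moreover have "((\<lambda>y. h x - v y) \<longlongrightarrow> h x - ((r x + 2 * dist x x) ^ n * \<omega> - r x ^ n * \<omega>)) (at x within S)"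
      unfolding v_def by (intro tendsto_intros r_cont)
    moreover have "\<forall>y. h x - v y \<le> h y" "\<forall>y. h y \<le> h x + u y"
      using step by (auto simp: u_def v_def algebra_simps)
    ultimately have "(h \<longlongrightarrow> h x) (at x within S)"
      using tendsto_sandwich[of "\<lambda>y. h x - v y" h "at x within S" "\<lambda>y. h x + u y" "h x"] by simp
    then show "((\<lambda>x. measure lborel (E \<inter> ball x (r x))) \<longlongrightarrow> measure lborel (E \<inter> ball x (r x))) (at x within S)"
      unfolding h_def .
  qed
qed

text \<open>A Vitali selection of disjoint balls of radius \<open>d / 50\<close> whose fivefold enlargements cover \<open>K\<close>. If \<open>z\<close> lies
in the enlarged ball around \<open>i\<close>, then \<open>d i\<close> is comparable to \<open>d z\<close>, so the small ball around \<open>i\<close> has volume at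
least that of a ball of radius \<open>d z / 100\<close> and sits inside the ball of radius \<open>d z\<close> around \<open>z\<close>. Since the
small balls are disjoint, there are at most \<open>100 ^ n\<close> of them.\<close>

lemma bounded_overlap_cover:
  fixes d :: "'a::euclidean_space \<Rightarrow> real"
  assumes lip: "\<And>x y. \<bar>d x - d y\<bar> \<le> dist x y" and K: "\<And>x. x \<in> K \<Longrightarrow> 0 < d x \<and> d x \<le> D"
  obtains C where "countable C" "C \<subseteq> K" "K \<subseteq> (\<Union>i\<in>C. ball i (d i / 10))"
    "\<And>z. (\<integral>\<^sup>+i. indicator (ball i (d i / 10)) z \<partial>count_space C) \<le> ennreal (100 ^ DIM('a))"
proof -
  have K': "0 < d i / 50 \<and> d i / 50 \<le> D / 50" if "i \<in> K" for i using K[OF that] by simp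
  obtain C where C: "countable C" "C \<subseteq> K"
    and disj: "pairwise (\<lambda>i j. disjnt (cball i (d i / 50)) (cball j (d j / 50))) C"
    and cov: "\<And>i. i \<in> K \<Longrightarrow> \<exists>j. j \<in> C \<and> \<not> disjnt (cball i (d i / 50)) (cball j (d j / 50)) \<and>
                        cball i (d i / 50) \<subseteq> ball j (5 * (d j / 50))"
    by (rule Vitali_covering_lemma_cballs_balls[where a="\<lambda>x. x" and r="\<lambda>i. d i / 50" and K=K, OF K'])
      (blast intro: that)+
  define n where "n = DIM('a)"
  define \<omega> where "\<omega> = measure lborel (ball (0::'a) 1)"
  have \<omega>: "0 < \<omega>" unfolding \<omega>_def by (rule content_ball_pos) simp
  have vol: "emeasure lborel (ball p \<rho>) = ennreal (\<rho> ^ n * \<omega>)" if "0 \<le> \<rho>" for p :: 'a and \<rho>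
    using that content_ball_conv_unit_ball[of \<rho> p] emeasure_eq_measure2[of "ball p \<rho>" lborel]
      ball_fmeasurable[of p \<rho>]
    by (simp add: \<omega>_def n_def)
  have "(\<integral>\<^sup>+i. indicator (ball i (d i / 10)) z \<partial>count_space C) \<le> ennreal (100 ^ n)" for z
  proof (cases "0 < d z")
    case False
    have "indicator (ball i (d i / 10)) z = (0::ennreal)" if "i \<in> C" for i
      using that C(2) K[of i] lip[of i z] False by (auto simp: indicator_def)
    then have "(\<integral>\<^sup>+i. indicator (ball i (d i / 10)) z \<partial>count_space C) = (\<integral>\<^sup>+i. 0 \<partial>count_space C)"
      by (intro nn_integral_cong) auto
    then show ?thesis by simp
  next
    case True
    \<comment> \<open>The small balls of the selection whose enlargement contains \<open>z\<close>: disjoint, and inside \<open>ball z (d z)\<close>.\<close>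
    define X where "X i = (if z \<in> ball i (d i / 10) then cball i (d i / 50) else {})" for i
    have X: "X i \<subseteq> ball z (d z)" if "i \<in> C" for i
    proof -
      have "dist z w < d z" if "dist i z < d i / 10" "dist i w \<le> d i / 50" for w
        using that lip[of i z] dist_triangle[of z w i] K[of i] C \<open>i \<in> C\<close> by (auto simp: dist_commute)
      then show ?thesis by (auto simp: X_def)
    qed
    have "ennreal ((d z / 100) ^ n * \<omega>) * (\<integral>\<^sup>+i. indicator (ball i (d i / 10)) z \<partial>count_space C)
      = (\<integral>\<^sup>+i. ennreal ((d z / 100) ^ n * \<omega>) * indicator (ball i (d i / 10)) z \<partial>count_space C)"
      by (rule nn_integral_cmult[symmetric]) simp
    also have "\<dots> \<le> (\<integral>\<^sup>+i. emeasure lborel (X i) \<partial>count_space C)"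
    proof (rule nn_integral_mono)
      fix i assume "i \<in> space (count_space C)"
      then have i: "i \<in> C" by simp
      show "ennreal ((d z / 100) ^ n * \<omega>) * indicator (ball i (d i / 10)) z \<le> emeasure lborel (X i)"
      proof (cases "z \<in> ball i (d i / 10)")
        case zi: True
        have "d z / 100 \<le> d i / 50" using zi lip[of i z] K[of i] C i by auto
        then have "ennreal ((d z / 100) ^ n * \<omega>) \<le> emeasure lborel (ball i (d i / 50))"
          using True \<omega> by (subst vol) (auto intro!: ennreal_leI mult_right_mono power_mono)
        also have "\<dots> \<le> emeasure lborel (cball i (d i / 50))"
          by (intro emeasure_mono ball_subset_cball) simp
        finally show ?thesis using zi by (simp add: X_def)
      qed simp
    qed
    also have "\<dots> = emeasure lborel (\<Union>i\<in>C. X i)"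
      using C disj by (intro emeasure_UN_countable[symmetric])
        (auto simp: X_def disjoint_family_on_def pairwise_def disjnt_def)
    also have "\<dots> \<le> emeasure lborel (ball z (d z))"
      using X by (intro emeasure_mono) auto
    also have "\<dots> = ennreal ((d z / 100) ^ n * \<omega>) * ennreal (100 ^ n)"
      using True \<omega> by (simp add: vol ennreal_mult[symmetric] power_divide)
    finally show ?thesis
      using True \<omega> by (subst (asm) ennreal_mult_le_mult_iff) auto
  qed
  moreover have "K \<subseteq> (\<Union>i\<in>C. ball i (d i / 10))"
  proof
    fix x assume "x \<in> K"
    then obtain j where "j \<in> C" "cball x (d x / 50) \<subseteq> ball j (5 * (d j / 50))" using cov by blast
    moreover have "x \<in> cball x (d x / 50)" using K[OF \<open>x \<in> K\<close>] by simp
    ultimately show "x \<in> (\<Union>i\<in>C. ball i (d i / 10))" by fastforce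
  qed
  ultimately show thesis using that C by (simp add: n_def)
qed

text \<open>Pairs crossing inside some \<open>B i\<close> are pairs crossing in \<open>\<Omega>\<close>, and each first point \<open>y\<close> lies in at most
\<open>N\<close> of the sets.\<close>

lemma sum_crossing_le:
  fixes k :: "'a::euclidean_space \<Rightarrow> 'a \<Rightarrow> ennreal"
  assumes "countable C" and k: "case_prod k \<in> borel_measurable (borel \<Otimes>\<^sub>M borel)"
    and [measurable]: "E \<in> sets borel" "\<Omega> \<in> sets borel" "\<And>i. i \<in> C \<Longrightarrow> B i \<in> sets borel"
    and B: "\<And>i. i \<in> C \<Longrightarrow> B i \<subseteq> \<Omega>"
    and overlap: "\<And>z. (\<integral>\<^sup>+i. indicator (B i) z \<partial>count_space C) \<le> N"
  shows "(\<integral>\<^sup>+i. crossing k (E \<inter> B i) (B i - E) \<partial>count_space C) \<le> N * crossing k (E \<inter> \<Omega>) (\<Omega> - E)"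
proof -
  define G where "G y = (\<integral>\<^sup>+z. k y z * indicator (\<Omega> - E) z \<partial>lborel) * indicator (E \<inter> \<Omega>) y" for y
  note k[measurable]
  have [measurable]: "G \<in> borel_measurable borel" unfolding G_def by measurable
  have "(\<integral>\<^sup>+i. crossing k (E \<inter> B i) (B i - E) \<partial>count_space C)
      \<le> (\<integral>\<^sup>+i. (\<integral>\<^sup>+y. G y * indicator (B i) y \<partial>lborel) \<partial>count_space C)"
    unfolding crossing_def G_def using B
    by (intro nn_integral_mono) (auto simp: indicator_def subset_iff intro!: nn_integral_mono)
  also have "\<dots> = (\<integral>\<^sup>+y. (\<integral>\<^sup>+i. G y * indicator (B i) y \<partial>count_space C) \<partial>lborel)"
    using assms by (intro nn_integral_count_space_nn_integral[symmetric]) auto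
  also have "\<dots> = (\<integral>\<^sup>+y. G y * (\<integral>\<^sup>+i. indicator (B i) y \<partial>count_space C) \<partial>lborel)"
    by (intro nn_integral_cong nn_integral_cmult) simp
  also have "\<dots> \<le> (\<integral>\<^sup>+y. N * G y \<partial>lborel)"
    using overlap by (intro nn_integral_mono) (subst mult.commute, simp add: mult_right_mono)
  also have "\<dots> = N * (\<integral>\<^sup>+y. G y \<partial>lborel)"
    by (rule nn_integral_cmult) simp
  also have "(\<integral>\<^sup>+y. G y \<partial>lborel) = crossing k (E \<inter> \<Omega>) (\<Omega> - E)"
    by (simp add: crossing_def G_def)
  finally show ?thesis .
qed

section \<open>Medians\<close>

text \<open>The infimum \<open>c\<close> of the levels \<open>t\<close> for which \<open>{F > t}\<close> fills at most half of \<open>B\<close> works: \<open>{F > c}\<close> is an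
increasing union of sets \<open>{F > t}\<close> with \<open>t > c\<close>, and \<open>{F < c}\<close> one of sets \<open>{F \<le> t}\<close> with \<open>t < c\<close>, whose
complements fill more than half.\<close>

lemma exists_median:
  fixes F :: "'a::euclidean_space \<Rightarrow> real"
  assumes F[measurable]: "F \<in> borel_measurable borel" and B: "B \<in> fmeasurable lborel" "0 < measure lborel B"
    and bound: "\<And>x. x \<in> B \<Longrightarrow> \<bar>F x\<bar> \<le> L"
  obtains c where "2 * measure lborel ({x. c < F x} \<inter> B) \<le> measure lborel B"
    "2 * measure lborel ({x. F x < c} \<inter> B) \<le> measure lborel B"
proof -
  have B'[measurable]: "B \<in> sets borel" using B by auto
  define v where "v X = measure lborel (X \<inter> B)" for X
  have fm: "X \<inter> B \<in> fmeasurable lborel" if "X \<in> sets borel" for X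
    using B that by (intro fmeasurableI2[OF B(1)]) auto
  have v_mono: "v X \<le> v Y" if "X \<subseteq> Y" "X \<in> sets borel" "Y \<in> sets borel" for X Y
    unfolding v_def using that fm by (intro measure_mono_fmeasurable) auto
  have v_union: "2 * v (\<Union>n. A n) \<le> measure lborel B"
    if A: "\<And>n. A n \<in> sets borel" "incseq A" "\<And>n. 2 * v (A n) \<le> measure lborel B" for A :: "nat \<Rightarrow> 'a set"
  proof -
    have "(\<lambda>n. measure lborel (A n \<inter> B)) \<longlonglongrightarrow> measure lborel (\<Union>n. A n \<inter> B)"
    proof (rule Lim_measure_incseq)
      show "emeasure lborel (\<Union>n. A n \<inter> B) \<noteq> \<infinity>"
        using fm[of "\<Union>n. A n"] A(1) by (auto simp: fmeasurable_def)
    qed (use A in \<open>auto simp: incseq_def\<close>)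
    then have "(\<lambda>n. 2 * v (A n)) \<longlonglongrightarrow> 2 * v (\<Union>n. A n)"
      unfolding v_def by (intro tendsto_intros) simp
    then show ?thesis by (rule LIMSEQ_le_const2) (use A(3) in auto)
  qed
  have [measurable]: "{x. t < F x} \<in> sets borel" "{x. F x \<le> t} \<in> sets borel" for t
  proof -
    have "{x \<in> space borel. t < F x} \<in> sets borel" "{x \<in> space borel. F x \<le> t} \<in> sets borel" by measurable
    then show "{x. t < F x} \<in> sets borel" "{x. F x \<le> t} \<in> sets borel" by simp_all
  qed
  define T where "T = {t. 2 * v {x. t < F x} \<le> measure lborel B}"
  have "{x. L < F x} \<inter> B = {}" using bound by (force simp: abs_le_iff)
  then have "L \<in> T" using B by (simp add: T_def v_def)
  have low: "- L - 1 \<le> t" if "t \<in> T" for t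
  proof (rule ccontr)
    assume "\<not> - L - 1 \<le> t"
    then have "{x. t < F x} \<inter> B = B" using bound by (force simp: abs_le_iff)
    then show False using that B by (simp add: T_def v_def)
  qed
  have up: "u \<in> T" if "t \<in> T" "t \<le> u" for t u
  proof -
    have "v {x. u < F x} \<le> v {x. t < F x}" using that by (intro v_mono) auto
    then show ?thesis using that by (simp add: T_def)
  qed
  define c where "c = Inf T"
  have bdd: "bdd_below T" using low by (auto simp: bdd_below_def)
  have above: "t \<in> T" if "c < t" for t
    using cInf_lessD[of T t] that \<open>L \<in> T\<close> up unfolding c_def by (metis empty_iff less_imp_le)
  have below: "t \<notin> T" if "t < c" for t
    using that cInf_lower[OF _ bdd, of t] by (auto simp: c_def)
  have "2 * v (\<Union>n. {x. c + inverse (real (Suc n)) < F x}) \<le> measure lborel B"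
  proof (rule v_union)
    show "incseq (\<lambda>n. {x. c + inverse (real (Suc n)) < F x})"
    proof (rule incseq_SucI, safe)
      fix n x assume "c + inverse (real (Suc n)) < F x"
      moreover have "inverse (real (Suc (Suc n))) \<le> inverse (real (Suc n))" by (intro le_imp_inverse_le) auto
      ultimately show "c + inverse (real (Suc (Suc n))) < F x" by linarith
    qed
    show "2 * v {x. c + inverse (real (Suc n)) < F x} \<le> measure lborel B" for n
      using above[of "c + inverse (real (Suc n))"] by (simp add: T_def)
  qed measurable
  also have "(\<Union>n. {x. c + inverse (real (Suc n)) < F x}) = {x. c < F x}"
  proof (intro equalityI subsetI)
    fix x assume "x \<in> {x. c < F x}"
    then obtain n where "inverse (real (Suc n)) < F x - c" using reals_Archimedean[of "F x - c"] by auto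
    then show "x \<in> (\<Union>n. {x. c + inverse (real (Suc n)) < F x})" by (auto simp: algebra_simps intro!: exI[of _ n])
  next
    fix x assume "x \<in> (\<Union>n. {x. c + inverse (real (Suc n)) < F x})"
    then obtain n where "c + inverse (real (Suc n)) < F x" by auto
    moreover have "0 < inverse (real (Suc n))" by simp
    ultimately have "c < F x" by linarith
    then show "x \<in> {x. c < F x}" by simp
  qed
  finally have 1: "2 * v {x. c < F x} \<le> measure lborel B" .
  have "2 * v (\<Union>n. {x. F x \<le> c - inverse (real (Suc n))}) \<le> measure lborel B"
  proof (rule v_union)
    show "incseq (\<lambda>n. {x. F x \<le> c - inverse (real (Suc n))})"
    proof (rule incseq_SucI, safe)
      fix n x assume "F x \<le> c - inverse (real (Suc n))"
      moreover have "inverse (real (Suc (Suc n))) \<le> inverse (real (Suc n))" by (intro le_imp_inverse_le) auto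
      ultimately show "F x \<le> c - inverse (real (Suc (Suc n)))" by linarith
    qed
    show "2 * v {x. F x \<le> c - inverse (real (Suc n))} \<le> measure lborel B" for n
    proof -
      define t where "t = c - inverse (real (Suc n))"
      have "t < c" by (simp add: t_def)
      then have "measure lborel B < 2 * v {x. t < F x}" using below by (auto simp: T_def not_le)
      moreover have "{x. F x \<le> t} \<inter> B = B - {x. t < F x} \<inter> B" by auto
      then have "v {x. F x \<le> t} = measure lborel B - v {x. t < F x}"
        unfolding v_def using fm[of "{x. t < F x}"] B by (simp add: measurable_measure_Diff)
      ultimately show ?thesis by (simp add: t_def)
    qed
  qed measurable
  also have "(\<Union>n. {x. F x \<le> c - inverse (real (Suc n))}) = {x. F x < c}"
  proof (intro equalityI subsetI)
    fix x assume "x \<in> {x. F x < c}"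
    then obtain n where "inverse (real (Suc n)) < c - F x" using reals_Archimedean[of "c - F x"] by auto
    then show "x \<in> (\<Union>n. {x. F x \<le> c - inverse (real (Suc n))})" by (auto simp: algebra_simps intro!: exI[of _ n])
  next
    fix x assume "x \<in> (\<Union>n. {x. F x \<le> c - inverse (real (Suc n))})"
    then obtain n where "F x \<le> c - inverse (real (Suc n))" by auto
    moreover have "0 < inverse (real (Suc n))" by simp
    ultimately have "F x < c" by linarith
    then show "x \<in> {x. F x < c}" by simp
  qed
  finally have 2: "2 * v {x. F x < c} \<le> measure lborel B" .
  show thesis using that 1 2 by (simp add: v_def)
qed

section \<open>John domains and their Whitney balls\<close>

text \<open>The geometric data that the argument uses, with \<open>d\<close> in the role of the distance to the boundary, together
with the conditions on the exponents.\<close>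

locale fractional_john =
  fixes \<Omega> :: "'a::euclidean_space set" and d :: "'a \<Rightarrow> real" and D l K \<beta> s q a b :: real
  assumes open_domain: "open \<Omega>" and bounded_domain: "bounded \<Omega>" and zero_mem: "0 \<in> \<Omega>"
    and lip: "\<bar>d x - d y\<bar> \<le> dist x y"
    and d_nonneg: "0 \<le> d x"
    and d_pos: "x \<in> \<Omega> \<Longrightarrow> 0 < d x"
    and d_le: "x \<in> \<Omega> \<Longrightarrow> d x \<le> D"
    and ball_subset_domain: "x \<in> \<Omega> \<Longrightarrow> ball x (d x) \<subseteq> \<Omega>"
    and john: "y \<in> \<Omega> \<Longrightarrow> \<exists>g. continuous_on {0..1} g \<and> g 0 = y \<and> g 1 = 0 \<and>
        (\<forall>t\<in>{0..1}. g t \<in> \<Omega> \<and> l * t powr \<beta> \<le> d (g t) \<and> dist y (g t) \<le> K * t)"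
    and l_pos: "0 < l" and K_pos: "0 < K" and beta: "1 \<le> \<beta>"
    and s: "0 < s" "s < 1"
    and q: "1 \<le> q" "q \<le> DIM('a) / (DIM('a) - s)"
    and a: "0 \<le> a"
    and b: "b \<le> (DIM('a) + a) / (q * \<beta>) + s - DIM('a)"
begin

definition kern :: "'a \<Rightarrow> 'a \<Rightarrow> ennreal" where
  "kern x z = (if norm (x - z) \<le> d x / 2
     then ennreal (min (d x) (d z) powr b / norm (z - x) powr (DIM('a) + s)) else 0)"

definition wmeas :: "'a measure" where
  "wmeas = density lborel (\<lambda>y. ennreal (d y powr a) * indicator \<Omega> y)"

text \<open>Whitney balls. The factor \<open>1 / 10\<close> leaves room for the cut-off \<open>|x - z| \<le> d x / 2\<close>: it holds for all pairs of
points of one such ball.\<close>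

abbreviation wball :: "'a \<Rightarrow> 'a set" where
  "wball x \<equiv> ball x (d x / 10)"

abbreviation vol :: "'a set \<Rightarrow> real" where
  "vol A \<equiv> measure lborel A"

definition unit_vol :: real where
  "unit_vol = vol (ball (0::'a) 1)"

definition half_density :: "'a set \<Rightarrow> 'a set" where
  "half_density E = {x \<in> \<Omega>. 2 * vol (E \<inter> wball x) = vol (wball x)}"

lemma D_pos: "0 < D"
  using d_pos[OF zero_mem] d_le[OF zero_mem] by simp

lemma continuous_d: "continuous_on S d"
  using lip by (intro lipschitz_on_continuous_on[of 1] lipschitz_onI) (auto simp: dist_real_def)

lemma borel_domain [measurable]: "\<Omega> \<in> sets borel"
  using open_domain by simp

lemma borel_d [measurable]: "d \<in> borel_measurable borel"
  by (intro borel_measurable_continuous_onI continuous_d)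

lemma kern_measurable [measurable]: "case_prod kern \<in> borel_measurable (borel \<Otimes>\<^sub>M borel)"
  unfolding kern_def by measurable

lemma sets_wmeas [measurable_cong]: "sets wmeas = sets borel"
  by (simp add: wmeas_def)

lemma space_wmeas [simp]: "space wmeas = UNIV"
  by (simp add: wmeas_def)

lemma wball_d:
  assumes "x \<in> \<Omega>" "y \<in> wball x"
  shows "9 / 10 * d x \<le> d y" "d y \<le> 11 / 10 * d x"
  using assms lip[of x y] by auto

lemma wball_subset: "x \<in> \<Omega> \<Longrightarrow> wball x \<subseteq> \<Omega>"
  using ball_subset_domain[of x] d_pos[of x] by (auto intro: subset_ball[THEN subsetD])

lemma wball_cover:
  assumes "A \<subseteq> \<Omega>"
  obtains C where "countable C" "C \<subseteq> A" "A \<subseteq> (\<Union>i\<in>C. wball i)"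
    "\<And>z. (\<integral>\<^sup>+i. indicator (wball i) z \<partial>count_space C) \<le> ennreal (100 ^ DIM('a))"
proof -
  have "0 < d x \<and> d x \<le> D" if "x \<in> A" for x using that assms d_pos d_le by auto
  from bounded_overlap_cover[OF lip this that] show thesis .
qed

text \<open>The condition on \<open>b\<close> for \<open>\<beta> = 1\<close>, which is what the local estimate in a Whitney ball needs.\<close>

lemma exponent_le: "b \<le> (DIM('a) + a) / q + s - DIM('a)"
proof -
  have "q * 1 \<le> q * \<beta>" using q beta by (intro mult_left_mono) auto
  then have "(DIM('a) + a) / (q * \<beta>) \<le> (DIM('a) + a) / q"
    using q a beta by (intro divide_left_mono) auto
  then show ?thesis using b by simp
qed

lemma s_lt_dim: "s < DIM('a)"
  using s DIM_positive[where 'a='a] by (simp add: Suc_le_eq le_trans less_le_trans[of s 1])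

text \<open>The exponent of the local isoperimetric inequality is at most \<open>1 / q\<close>: this is the upper bound on \<open>q\<close>.\<close>

lemma inverse_q_ge: "1 - s / DIM('a) \<le> 1 / q"
proof -
  have "0 < real DIM('a) - s" "0 < real DIM('a)" using s_lt_dim by auto
  then have "q * (DIM('a) - s) \<le> DIM('a)" using q by (simp add: field_simps)
  then have "(DIM('a) - s) / DIM('a) \<le> 1 / q" using q \<open>0 < real DIM('a)\<close> by (simp add: field_simps)
  then show ?thesis using \<open>0 < real DIM('a)\<close> by (simp add: field_simps)
qed

lemma emeasure_wmeas_le:
  assumes A: "A \<in> sets borel" "A \<subseteq> B" and B: "B \<in> fmeasurable lborel"
    and "\<And>y. y \<in> A \<inter> \<Omega> \<Longrightarrow> d y \<le> T"
  shows "emeasure wmeas A \<le> ennreal (T powr a * vol B)"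
proof -
  note A(1)[measurable]
  have "emeasure wmeas A = (\<integral>\<^sup>+y. ennreal (d y powr a) * indicator \<Omega> y * indicator A y \<partial>lborel)"
    unfolding wmeas_def by (rule emeasure_density) measurable
  also have "\<dots> \<le> (\<integral>\<^sup>+y. ennreal (T powr a) * indicator B y \<partial>lborel)"
    using assms a d_nonneg by (intro nn_integral_mono) (auto simp: indicator_def intro!: ennreal_leI powr_mono2)
  also have "\<dots> = ennreal (T powr a) * emeasure lborel B"
    using B by (intro nn_integral_cmult_indicator) auto
  also have "\<dots> = ennreal (T powr a * vol B)"
    using B by (simp add: emeasure_eq_measure2 ennreal_mult)
  finally show ?thesis .
qed

lemma finite_wmeas: "finite_measure wmeas"
proof
  obtain R where "\<Omega> \<subseteq> ball 0 R"
    using bounded_domain bounded_subset_ballD by blast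
  then have "\<Omega> = \<Omega> \<inter> ball 0 R" by auto
  then have fin: "\<Omega> \<in> fmeasurable lborel" using Int_ball_fmeasurable[of \<Omega> 0 R] by simp
  have "emeasure wmeas (space wmeas) = emeasure wmeas \<Omega>"
    by (simp add: wmeas_def emeasure_density) (auto intro!: nn_integral_cong simp: indicator_def)
  also have "\<dots> \<le> ennreal (D powr a * vol \<Omega>)"
    using fin d_le by (intro emeasure_wmeas_le) auto
  finally show "emeasure wmeas (space wmeas) \<noteq> \<infinity>"
    by (auto simp: top_unique)
qed

section \<open>The inequality for a single level set\<close>

text \<open>Inside a Whitney ball \<open>d\<close> varies by a factor of at most 2 and any two points are close enough for the
kernel not to be cut off, so the unweighted isoperimetric inequality carries over with the
weight \<open>d x powr b\<close>.\<close>

lemma isoperimetric_wball: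
  obtains c where "0 < c"
    "\<And>x E. x \<in> \<Omega> \<Longrightarrow> E \<in> sets borel \<Longrightarrow> 2 * vol (E \<inter> wball x) \<le> vol (wball x) \<Longrightarrow>
       ennreal (c * d x powr b * vol (E \<inter> wball x) powr (1 - s / DIM('a)))
         \<le> crossing kern (E \<inter> wball x) (wball x - E)"
proof -
  define k0 where "k0 y z = ennreal (1 / norm (z - y) powr (DIM('a) + s))" for y z :: 'a
  have k0[measurable]: "case_prod k0 \<in> borel_measurable (borel \<Otimes>\<^sub>M borel)"
    unfolding k0_def by measurable
  obtain c where c: "0 < c" and iso:
    "\<And>(x::'a) R E. 0 < R \<Longrightarrow> E \<in> sets borel \<Longrightarrow>
       2 * vol (E \<inter> ball x R) \<le> vol (ball x R) \<Longrightarrow>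
       ennreal (c * vol (E \<inter> ball x R) powr (1 - s / DIM('a))) \<le> crossing k0 (E \<inter> ball x R) (ball x R - E)"
    using isoperimetric_ball[OF s(1)] unfolding k0_def by blast
  have "ennreal ((2 powr (- \<bar>b\<bar>) * c) * d x powr b * vol (E \<inter> wball x) powr (1 - s / DIM('a)))
         \<le> crossing kern (E \<inter> wball x) (wball x - E)"
    if x: "x \<in> \<Omega>" and E[measurable]: "E \<in> sets borel" and half: "2 * vol (E \<inter> wball x) \<le> vol (wball x)" for x E
  proof -
    define w where "w = 2 powr (- \<bar>b\<bar>) * d x powr b"
    have "ennreal ((2 powr (- \<bar>b\<bar>) * c) * d x powr b * vol (E \<inter> wball x) powr (1 - s / DIM('a)))
      = ennreal w * ennreal (c * vol (E \<inter> wball x) powr (1 - s / DIM('a)))"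
      using c by (simp add: w_def ennreal_mult[symmetric] mult_ac)
    also have "\<dots> \<le> ennreal w * crossing k0 (E \<inter> wball x) (wball x - E)"
      using x d_pos[of x] half by (intro mult_left_mono iso) auto
    also have "\<dots> = crossing (\<lambda>y z. ennreal w * k0 y z) (E \<inter> wball x) (wball x - E)"
      by (rule crossing_cmult[symmetric]) auto
    also have "\<dots> \<le> crossing kern (E \<inter> wball x) (wball x - E)"
    proof (rule crossing_mono)
      fix y z assume "y \<in> E \<inter> wball x" "z \<in> wball x - E"
      then have y: "y \<in> wball x" and z: "z \<in> wball x" by auto
      have "dist y z \<le> dist x y + dist x z" by (metis dist_commute dist_triangle)
      then have near: "norm (y - z) \<le> d y / 2"
        using y z wball_d[OF x y] d_pos[OF x] by (simp add: dist_norm)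
      have "w \<le> min (d y) (d z) powr b"
        unfolding w_def using wball_d[OF x y] wball_d[OF x z] d_pos[OF x]
        by (intro powr_comparable) auto
      then have "ennreal w * k0 y z \<le> ennreal (min (d y) (d z) powr b / norm (z - y) powr (DIM('a) + s))"
        by (simp add: k0_def w_def ennreal_mult[symmetric] divide_right_mono ennreal_leI)
      then show "ennreal w * k0 y z \<le> kern y z"
        using near by (simp add: kern_def)
    qed auto
    finally show ?thesis .
  qed
  then show thesis using c by (intro that[of "2 powr (- \<bar>b\<bar>) * c"]) auto
qed

lemma vol_ball: "0 \<le> r \<Longrightarrow> vol (ball (p::'a) r) = r ^ DIM('a) * unit_vol"
  unfolding unit_vol_def by (rule content_ball_conv_unit_ball)

lemma unit_vol_pos: "0 < unit_vol"
  unfolding unit_vol_def by (rule content_ball_pos) simp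

text \<open>With \<open>m\<close> the volume of \<open>E\<close> in the ball and \<open>\<rho> = d x\<close>, the measure is at most of order \<open>\<rho> powr a * m\<close>. The isoperimetric
inequality controls \<open>m powr (1 - s/n)\<close>; the remaining power \<open>e = 1/q - (1 - s/n)\<close> of \<open>m\<close> is nonnegative
and is estimated by the volume of a ball of radius \<open>\<rho>\<close>. The surplus exponent of \<open>\<rho>\<close> is nonnegative by
\<open>exponent_le\<close>, so that power is absorbed by the bound \<open>D\<close>.\<close>

lemma low_density_piece:
  obtains k where "0 \<le> k"
    "\<And>x E p. x \<in> \<Omega> \<Longrightarrow> E \<in> sets borel \<Longrightarrow> 2 * vol (E \<inter> wball x) \<le> vol (wball x) \<Longrightarrow> 0 \<le> p \<Longrightarrow>
       crossing kern (E \<inter> wball x) (wball x - E) = ennreal p \<Longrightarrow>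
       emeasure wmeas (E \<inter> wball x) \<le> ennreal ((k * p) powr q)"
proof -
  define n where "n = real DIM('a)"
  have n: "0 < n" by (simp add: n_def)
  define \<omega> where "\<omega> = unit_vol"
  have \<omega>: "0 < \<omega>" unfolding \<omega>_def by (rule unit_vol_pos)
  obtain c where c: "0 < c" and iso: "\<And>x E. x \<in> \<Omega> \<Longrightarrow> E \<in> sets borel \<Longrightarrow> 2 * vol (E \<inter> wball x) \<le> vol (wball x) \<Longrightarrow>
       ennreal (c * d x powr b * vol (E \<inter> wball x) powr (1 - s / n))
         \<le> crossing kern (E \<inter> wball x) (wball x - E)"
    using isoperimetric_wball unfolding n_def by blast
  define e where "e = 1 / q - (1 - s / n)"
  have e: "0 \<le> e" using inverse_q_ge by (simp add: e_def n_def)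
  define \<theta> where "\<theta> = (n + a) / q + s - n"
  have \<theta>: "b \<le> \<theta>" using exponent_le by (simp add: \<theta>_def n_def)
  define k where "k = 2 powr (a / q) * \<omega> powr e * D powr (\<theta> - b) / c"
  have "emeasure wmeas (E \<inter> wball x) \<le> ennreal ((k * p) powr q)"
    if x: "x \<in> \<Omega>" and E: "E \<in> sets borel" and half: "2 * vol (E \<inter> wball x) \<le> vol (wball x)" and p: "0 \<le> p"
      and cr: "crossing kern (E \<inter> wball x) (wball x - E) = ennreal p" for x E p
  proof -
    define m where "m = vol (E \<inter> wball x)"
    define \<rho> where "\<rho> = d x"
    have m0: "0 \<le> m" by (simp add: m_def)
    have \<rho>: "0 < \<rho>" "\<rho> \<le> D" using d_pos[OF x] d_le[OF x] by (auto simp: \<rho>_def)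
    have cp: "c * \<rho> powr b * m powr (1 - s / n) \<le> p"
      using iso[OF x E half] p by (simp add: cr m_def \<rho>_def)
    have "m \<le> vol (ball x \<rho>)"
      unfolding m_def using E \<rho> by (intro measure_mono_fmeasurable ball_fmeasurable) (auto simp: \<rho>_def)
    also have "\<dots> = \<rho> powr n * \<omega>"
      using \<rho> by (simp add: vol_ball \<omega>_def n_def powr_realpow)
    finally have m_le: "m \<le> \<rho> powr n * \<omega>" .
    have "emeasure wmeas (E \<inter> wball x) \<le> ennreal ((2 * \<rho>) powr a * m)"
      unfolding m_def using E wball_d[OF x] \<rho>
      by (intro emeasure_wmeas_le Int_ball_fmeasurable) (force simp: \<rho>_def)+
    also have "(2 * \<rho>) powr a * m \<le> (k * p) powr q"
    proof -
      have "m powr (1 / q) = m powr (1 - s / n) * m powr e"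
        by (simp add: e_def powr_add[symmetric])
      also have "\<dots> \<le> m powr (1 - s / n) * (\<rho> powr n * \<omega>) powr e"
        using e m0 m_le by (intro mult_left_mono powr_mono2) auto
      finally have "((2 * \<rho>) powr a * m) powr (1 / q)
          \<le> (2 * \<rho>) powr (a / q) * (m powr (1 - s / n) * (\<rho> powr n * \<omega>) powr e)"
        using m0 by (simp add: powr_mult powr_powr mult_left_mono)
      also have "\<dots> = 2 powr (a / q) * \<omega> powr e * m powr (1 - s / n) * \<rho> powr \<theta>"
      proof -
        have "\<theta> = a / q + n * e" using n by (simp add: \<theta>_def e_def field_simps add_divide_distrib)
        then have "\<rho> powr \<theta> = \<rho> powr (a / q) * \<rho> powr (n * e)" by (simp add: powr_add)
        then show ?thesis using \<rho> \<omega> by (simp add: powr_mult powr_powr mult_ac)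
      qed
      also have "\<dots> \<le> 2 powr (a / q) * \<omega> powr e * m powr (1 - s / n) * (D powr (\<theta> - b) * \<rho> powr b)"
        using powr_le_scale[OF \<rho> \<theta>] by (intro mult_left_mono) auto
      also have "\<dots> = k * (c * \<rho> powr b * m powr (1 - s / n))"
        using c by (simp add: k_def field_simps)
      also have "\<dots> \<le> k * p"
        using cp c by (intro mult_left_mono) (auto simp: k_def)
      finally have "(((2 * \<rho>) powr a * m) powr (1 / q)) powr q \<le> (k * p) powr q"
        using q by (intro powr_mono2) auto
      then show ?thesis using q m0 by (simp add: powr_powr)
    qed
    finally show ?thesis by (simp add: ennreal_leI)
  qed
  moreover have "0 \<le> k" using c by (simp add: k_def)
  ultimately show thesis using that by blast
qed

text \<open>At a point of density one half the volume in the isoperimetric inequality is comparable to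
\<open>d x powr n\<close>, so the crossing energy is at least of order \<open>d x powr (b + n - s)\<close>. The set \<open>S\<close> has measure at most of
order \<open>d x powr ((n + a)/\<beta>)\<close>, and the hypothesis on \<open>b\<close> compares the exponents.\<close>

lemma half_density_piece:
  assumes "0 < M"
  obtains k where "0 \<le> k"
    "\<And>x E p S. x \<in> half_density E \<Longrightarrow> E \<in> sets borel \<Longrightarrow> 0 \<le> p \<Longrightarrow>
       crossing kern (E \<inter> wball x) (wball x - E) = ennreal p \<Longrightarrow>
       S \<in> sets borel \<Longrightarrow> (\<And>y. y \<in> S \<Longrightarrow> dist x y \<le> M * d x powr (1 / \<beta>) \<and> d y \<le> M * d x powr (1 / \<beta>)) \<Longrightarrow>
       emeasure wmeas S \<le> ennreal ((k * p) powr q)"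
proof -
  define n where "n = real DIM('a)"
  have n: "0 < n" by (simp add: n_def)
  define \<omega> where "\<omega> = unit_vol"
  have \<omega>: "0 < \<omega>" unfolding \<omega>_def by (rule unit_vol_pos)
  obtain c where c: "0 < c" and iso: "\<And>x E. x \<in> \<Omega> \<Longrightarrow> E \<in> sets borel \<Longrightarrow> 2 * vol (E \<inter> wball x) \<le> vol (wball x) \<Longrightarrow>
       ennreal (c * d x powr b * vol (E \<inter> wball x) powr (1 - s / n))
         \<le> crossing kern (E \<inter> wball x) (wball x - E)"
    using isoperimetric_wball unfolding n_def by blast
  define c' where "c' = c * (\<omega> / (2 * 10 powr n)) powr (1 - s / n)"
  have c': "0 < c'" using c \<omega> by (simp add: c'_def)
  define \<theta> where "\<theta> = (n + a) / (q * \<beta>)"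
  have \<theta>: "b + n - s \<le> \<theta>" using b by (simp add: \<theta>_def n_def)
  define k where "k = (M powr a * (2 * M) powr n * \<omega>) powr (1 / q) * D powr (\<theta> - (b + n - s)) / c'"
  have "emeasure wmeas S \<le> ennreal ((k * p) powr q)"
    if x: "x \<in> half_density E" and E: "E \<in> sets borel" and p: "0 \<le> p"
      and cr: "crossing kern (E \<inter> wball x) (wball x - E) = ennreal p"
      and S: "S \<in> sets borel" "\<And>y. y \<in> S \<Longrightarrow> dist x y \<le> M * d x powr (1 / \<beta>) \<and> d y \<le> M * d x powr (1 / \<beta>)"
    for x E p S
  proof -
    define \<rho> where "\<rho> = d x"
    have x': "x \<in> \<Omega>" "2 * vol (E \<inter> wball x) = vol (wball x)" using x by (auto simp: half_density_def)
    have \<rho>: "0 < \<rho>" "\<rho> \<le> D" using d_pos x' d_le by (auto simp: \<rho>_def)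
    define W where "W = \<omega> / (2 * 10 powr n)"
    have W: "0 < W" using \<omega> by (simp add: W_def)
    have "vol (E \<inter> wball x) = \<rho> powr n * W"
      using \<rho> x' by (simp add: vol_ball W_def \<rho>_def \<omega>_def n_def powr_realpow power_divide)
    then have "vol (E \<inter> wball x) powr (1 - s / n) = \<rho> powr (n - s) * W powr (1 - s / n)"
      using W \<rho> n by (simp add: powr_mult powr_powr right_diff_distrib)
    moreover have "\<rho> powr (b + n - s) = \<rho> powr b * \<rho> powr (n - s)"
      by (simp add: powr_add[symmetric] add_diff_eq)
    ultimately have "c' * \<rho> powr (b + n - s) = c * \<rho> powr b * vol (E \<inter> wball x) powr (1 - s / n)"
      by (simp add: c'_def W_def mult_ac)
    then have cp: "c' * \<rho> powr (b + n - s) \<le> p"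
      using iso[OF x'(1) E] x' p by (simp add: cr \<rho>_def)
    define T where "T = M * \<rho> powr (1 / \<beta>)"
    have T: "0 < T" using assms \<rho> by (simp add: T_def)
    have "emeasure wmeas S \<le> ennreal (T powr a * vol (ball x (2 * T)))"
    proof (rule emeasure_wmeas_le)
      show "S \<subseteq> ball x (2 * T)" using S(2) T by (force simp: T_def \<rho>_def)
    qed (use S in \<open>auto simp: T_def \<rho>_def intro: ball_fmeasurable\<close>)
    also have "T powr a * vol (ball x (2 * T)) \<le> (k * p) powr q"
    proof -
      have "vol (ball x (2 * T)) = (2 * T) powr n * \<omega>"
        using T by (simp add: vol_ball n_def powr_realpow \<omega>_def)
      then have "T powr a * vol (ball x (2 * T)) = (M powr a * (2 * M) powr n * \<omega>) * \<rho> powr ((n + a) / \<beta>)"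
        using assms \<rho> by (simp add: T_def powr_mult powr_powr add_divide_distrib powr_add mult_ac)
      then have "(T powr a * vol (ball x (2 * T))) powr (1 / q) = (M powr a * (2 * M) powr n * \<omega>) powr (1 / q) * \<rho> powr \<theta>"
        using assms \<rho> \<omega> by (simp add: powr_mult powr_powr \<theta>_def mult.commute)
      also have "\<dots> \<le> (M powr a * (2 * M) powr n * \<omega>) powr (1 / q) * (D powr (\<theta> - (b + n - s)) * \<rho> powr (b + n - s))"
        using powr_le_scale[OF \<rho> \<theta>] by (intro mult_left_mono) auto
      also have "\<dots> = k * (c' * \<rho> powr (b + n - s))"
        using c' by (simp add: k_def)
      also have "\<dots> \<le> k * p"
        using cp c' by (intro mult_left_mono) (auto simp: k_def)
      finally have "((T powr a * vol (ball x (2 * T))) powr (1 / q)) powr q \<le> (k * p) powr q"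
        using q by (intro powr_mono2) auto
      then show ?thesis using q by (simp add: powr_powr)
    qed
    finally show ?thesis by (simp add: ennreal_leI)
  qed
  moreover have "0 \<le> k" using c' by (simp add: k_def)
  ultimately show thesis using that by blast
qed

text \<open>Along the John curve from \<open>x\<close> to the origin the density of \<open>E\<close> in the Whitney ball varies
continuously, so it takes the value one half, at a point \<open>h\<close> reached at time \<open>t\<close>. There \<open>l * t powr \<beta> \<le> d h\<close>
bounds \<open>t\<close>, and the speed bound makes \<open>dist x h\<close> at most of order \<open>t\<close>.\<close>

lemma high_density_reaches_half_density:
  obtains M where "0 < M"
    "\<And>x E. x \<in> \<Omega> \<Longrightarrow> E \<in> sets borel \<Longrightarrow> 2 * vol (E \<inter> wball x) > vol (wball x) \<Longrightarrow>
      2 * vol (E \<inter> wball 0) \<le> vol (wball 0) \<Longrightarrow>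
      \<exists>h\<in>half_density E. \<forall>y\<in>wball x. dist h y \<le> M * d h powr (1 / \<beta>)"
proof -
  \<comment> \<open>\<open>dist h y \<le> 2 * K * t + d h\<close> for \<open>y\<close> in the ball; both terms are of order \<open>d h powr (1/\<beta>)\<close>.\<close>
  define M where "M = 2 * K * (1 / l) powr (1 / \<beta>) + D powr (1 - 1 / \<beta>)"
  have "\<exists>h\<in>half_density E. \<forall>y\<in>wball x. dist h y \<le> M * d h powr (1 / \<beta>)"
    if x: "x \<in> \<Omega>" and E: "E \<in> sets borel" and hi: "2 * vol (E \<inter> wball x) > vol (wball x)"
      and lo: "2 * vol (E \<inter> wball 0) \<le> vol (wball 0)" for x E
  proof -
    obtain g where g: "continuous_on {0..1} g" "g 0 = x" "g 1 = 0"
      and g': "\<And>t. t \<in> {0..1} \<Longrightarrow> g t \<in> \<Omega> \<and> l * t powr \<beta> \<le> d (g t) \<and> dist x (g t) \<le> K * t"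
      using john[OF x] by blast
    define \<psi> where "\<psi> y = 2 * vol (E \<inter> wball y) - vol (wball y)" for y
    have dens: "continuous_on UNIV (\<lambda>y. vol (F \<inter> wball y))" if "F \<in> sets borel" for F
    proof (rule continuous_on_measure_Int_ball[OF that])
      show "\<bar>d x / 10 - d y / 10\<bar> \<le> dist x y" for x y using lip[of x y] by (auto simp: abs_if split: if_splits)
    qed (simp add: d_nonneg)
    have "continuous_on UNIV (\<lambda>y. 2 * vol (E \<inter> wball y) - vol (UNIV \<inter> wball y))"
      by (intro continuous_intros dens E) simp
    then have "continuous_on UNIV \<psi>" by (simp add: \<psi>_def)
    then have "continuous_on {0..1} (\<lambda>t. \<psi> (g t))"
      using continuous_on_compose2[OF _ g(1), of UNIV \<psi>] by auto
    then obtain t where t: "0 \<le> t" "t \<le> 1" "\<psi> (g t) = 0"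
      using IVT2'[of "\<lambda>t. \<psi> (g t)" 1 0 0] hi lo g by (auto simp: \<psi>_def)
    define h where "h = g t"
    have h: "h \<in> \<Omega>" "l * t powr \<beta> \<le> d h" "dist x h \<le> K * t" using g'[of t] t by (auto simp: h_def)
    have dh: "0 < d h" "d h \<le> D" using h d_pos d_le by auto
    have "t \<le> (1 / l) powr (1 / \<beta>) * d h powr (1 / \<beta>)"
    proof -
      have "t powr \<beta> \<le> 1 / l * d h" using h l_pos by (simp add: field_simps)
      then have "(t powr \<beta>) powr (1 / \<beta>) \<le> (1 / l * d h) powr (1 / \<beta>)"
        using beta by (intro powr_mono2) auto
      then show ?thesis using beta t l_pos dh by (simp add: powr_powr powr_mult powr_divide)
    qed
    then have Kt: "K * t \<le> K * ((1 / l) powr (1 / \<beta>) * d h powr (1 / \<beta>))"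
      using K_pos by (intro mult_left_mono) auto
    have d1: "d h \<le> D powr (1 - 1 / \<beta>) * d h powr (1 / \<beta>)"
      using powr_le_scale[OF dh, of "1 / \<beta>" 1] beta dh by simp
    have "dist h y \<le> M * d h powr (1 / \<beta>)" if "y \<in> wball x" for y
    proof -
      have "dist h y \<le> dist x h + dist x y" by (metis dist_commute dist_triangle)
      also have "\<dots> \<le> 2 * (K * t) + d h"
        using that h(3) lip[of x h] dh by auto
      also have "\<dots> \<le> M * d h powr (1 / \<beta>)"
        using Kt d1 by (simp add: M_def algebra_simps)
      finally show ?thesis .
    qed
    moreover have "h \<in> half_density E" using h t by (simp add: half_density_def h_def \<psi>_def)
    ultimately show ?thesis by blast
  qed
  moreover have "0 < M" using K_pos l_pos D_pos by (simp add: M_def add_pos_pos)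
  ultimately show thesis using that by blast
qed

text \<open>The set is split according to the density of \<open>E\<close> in the balls of a Whitney cover. The low-density
pieces are estimated where they are; the high-density balls are collected in neighbourhoods of
finitely overlapping balls centred at points of density one half.\<close>

lemma level_set_inequality:
  obtains k where "0 < k"
    "\<And>E. E \<in> sets borel \<Longrightarrow> 2 * vol (E \<inter> wball 0) \<le> vol (wball 0) \<Longrightarrow>
      ennreal (measure wmeas E powr (1 / q)) \<le> ennreal k * crossing kern (E \<inter> \<Omega>) (\<Omega> - E)"
proof -
  interpret finite_measure wmeas by (rule finite_wmeas)
  obtain k1 where k1: "0 \<le> k1" "\<And>x E p. x \<in> \<Omega> \<Longrightarrow> E \<in> sets borel \<Longrightarrow> 2 * vol (E \<inter> wball x) \<le> vol (wball x) \<Longrightarrow> 0 \<le> p \<Longrightarrow>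
       crossing kern (E \<inter> wball x) (wball x - E) = ennreal p \<Longrightarrow>
       emeasure wmeas (E \<inter> wball x) \<le> ennreal ((k1 * p) powr q)"
    using low_density_piece by blast
  obtain M0 where M0: "0 < M0" "\<And>x E. x \<in> \<Omega> \<Longrightarrow> E \<in> sets borel \<Longrightarrow> 2 * vol (E \<inter> wball x) > vol (wball x) \<Longrightarrow>
      2 * vol (E \<inter> wball 0) \<le> vol (wball 0) \<Longrightarrow>
      \<exists>h\<in>half_density E. \<forall>y\<in>wball x. dist h y \<le> M0 * d h powr (1 / \<beta>)"
    using high_density_reaches_half_density by blast
  \<comment> \<open>Replacing \<open>h\<close> by the centre \<open>j\<close> of a ball that contains it costs a factor 2 in \<open>d\<close> and a shift by
    \<open>d j / 10\<close>; the summand with \<open>D\<close> also covers the bound on \<open>d y \<le> d j + dist j y\<close>.\<close>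
  define M where "M = 2 * M0 + 2 * D powr (1 - 1 / \<beta>)"
  have M: "0 < M" using M0 by (simp add: M_def add_pos_nonneg)
  obtain k2 where k2: "0 \<le> k2" "\<And>x E p S. x \<in> half_density E \<Longrightarrow> E \<in> sets borel \<Longrightarrow> 0 \<le> p \<Longrightarrow>
       crossing kern (E \<inter> wball x) (wball x - E) = ennreal p \<Longrightarrow>
       S \<in> sets borel \<Longrightarrow> (\<And>y. y \<in> S \<Longrightarrow> dist x y \<le> M * d x powr (1 / \<beta>) \<and> d y \<le> M * d x powr (1 / \<beta>)) \<Longrightarrow>
       emeasure wmeas S \<le> ennreal ((k2 * p) powr q)"
    using half_density_piece[OF M] by blast
  define N :: real where "N = 100 ^ DIM('a)"
  have N: "0 < N" by (simp add: N_def)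
  \<comment> \<open>The factor 2 comes from adding two \<open>q\<close>-th powers; the summand 1 makes \<open>k\<close> positive, which the
    case of infinite crossing energy needs.\<close>
  define k where "k = 2 * (k1 * N + k2 * N) + 1"
  have k: "0 < k" using k1 k2 N by (simp add: k_def add_nonneg_pos)
  have "ennreal (measure wmeas E powr (1 / q)) \<le> ennreal k * crossing kern (E \<inter> \<Omega>) (\<Omega> - E)"
    if E[measurable]: "E \<in> sets borel" and lo: "2 * vol (E \<inter> wball 0) \<le> vol (wball 0)" for E
  proof (cases "crossing kern (E \<inter> \<Omega>) (\<Omega> - E)")
    case top
    then show ?thesis using k by (simp add: ennreal_mult_top)
  next
    case (real P)
    have pieces: "(\<integral>\<^sup>+i. crossing kern (E \<inter> wball i) (wball i - E) \<partial>count_space C) \<le> ennreal (N * P)"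
      if "countable C" "C \<subseteq> \<Omega>" "\<And>z. (\<integral>\<^sup>+i. indicator (wball i) z \<partial>count_space C) \<le> ennreal N" for C
      using sum_crossing_le[OF that(1) kern_measurable E borel_domain, of wball "ennreal N"] that wball_subset real N
      by (auto simp: ennreal_mult[symmetric])
    obtain C where "countable C" "C \<subseteq> \<Omega>" "\<Omega> \<subseteq> (\<Union>i\<in>C. wball i)"
      "\<And>z. (\<integral>\<^sup>+i. indicator (wball i) z \<partial>count_space C) \<le> ennreal (100 ^ DIM('a))"
      by (rule wball_cover[OF order_refl]) (rule that)
    note C = this[folded N_def]
    have "half_density E \<subseteq> \<Omega>" by (auto simp: half_density_def)
    then obtain C' where "countable C'" "C' \<subseteq> half_density E" "half_density E \<subseteq> (\<Union>i\<in>C'. wball i)"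
      "\<And>z. (\<integral>\<^sup>+i. indicator (wball i) z \<partial>count_space C') \<le> ennreal (100 ^ DIM('a))"
      by (rule wball_cover) (rule that)
    note C' = this[folded N_def]
    have C'\<Omega>: "C' \<subseteq> \<Omega>" using C' by (auto simp: half_density_def)
    define A where "A i = (if 2 * vol (E \<inter> wball i) \<le> vol (wball i) then E \<inter> wball i else {})" for i
    define S where "S j = {y \<in> \<Omega>. dist j y \<le> M * d j powr (1 / \<beta>) \<and> d y \<le> M * d j powr (1 / \<beta>)}" for j
    have [measurable]: "A i \<in> sets borel" "S i \<in> sets borel" for i
    proof -
      show "A i \<in> sets borel" by (simp add: A_def)
      have "S i = {y \<in> space borel. y \<in> \<Omega> \<and> dist i y \<le> M * d i powr (1 / \<beta>) \<and> d y \<le> M * d i powr (1 / \<beta>)}"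
        by (simp add: S_def)
      also have "\<dots> \<in> sets borel" by measurable
      finally show "S i \<in> sets borel" .
    qed
    have low: "emeasure wmeas (\<Union>i\<in>C. A i) \<le> ennreal ((k1 * (N * P)) powr q)"
      using C k1 N real q pieces[OF C(1,2,4)]
      by (intro emeasure_UN_le_powr[where p="\<lambda>i. crossing kern (E \<inter> wball i) (wball i - E)"])
        (auto simp: sets_wmeas A_def subset_iff)
    have high: "emeasure wmeas (\<Union>j\<in>C'. S j) \<le> ennreal ((k2 * (N * P)) powr q)"
    proof (rule emeasure_UN_le_powr[where p="\<lambda>i. crossing kern (E \<inter> wball i) (wball i - E)"])
      fix j p assume "j \<in> C'" "0 \<le> p" "crossing kern (E \<inter> wball j) (wball j - E) = ennreal p"
      then show "emeasure wmeas (S j) \<le> ennreal ((k2 * p) powr q)"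
        using C'(2) by (intro k2(2)[of j E]) (auto simp: S_def)
    qed (use C' C'\<Omega> k2 N real q pieces[OF C'(1) C'\<Omega> C'(4)] in \<open>auto simp: sets_wmeas\<close>)
    have cov: "E \<inter> \<Omega> \<subseteq> (\<Union>i\<in>C. A i) \<union> (\<Union>j\<in>C'. S j)"
    proof
      fix y assume y: "y \<in> E \<inter> \<Omega>"
      then obtain i where i: "i \<in> C" "y \<in> wball i" using C by auto
      show "y \<in> (\<Union>i\<in>C. A i) \<union> (\<Union>j\<in>C'. S j)"
      proof (cases "2 * vol (E \<inter> wball i) \<le> vol (wball i)")
        case True
        then show ?thesis using i y by (auto simp: A_def)
      next
        case False
        then obtain h where h: "h \<in> half_density E" "dist h y \<le> M0 * d h powr (1 / \<beta>)"
          using M0(2)[of i E] i C lo E by force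
        then obtain j where j: "j \<in> C'" "h \<in> wball j" using C' by auto
        have j\<Omega>: "j \<in> \<Omega>" using j C'\<Omega> by auto
        have dj: "0 < d j" "d j \<le> D" using j\<Omega> d_pos d_le by auto
        have "d h powr (1 / \<beta>) \<le> (2 * d j) powr (1 / \<beta>)"
          using wball_d[OF j\<Omega> j(2)] dj beta d_nonneg by (intro powr_mono2) auto
        also have "\<dots> = 2 powr (1 / \<beta>) * d j powr (1 / \<beta>)" using dj by (simp add: powr_mult)
        also have "\<dots> \<le> 2 * d j powr (1 / \<beta>)"
          using powr_mono[of "1 / \<beta>" 1 2] beta by (intro mult_right_mono) auto
        finally have 1: "M0 * d h powr (1 / \<beta>) \<le> 2 * M0 * d j powr (1 / \<beta>)"
          using M0 by simp
        have 2: "d j \<le> D powr (1 - 1 / \<beta>) * d j powr (1 / \<beta>)"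
          using powr_le_scale[OF dj, of "1 / \<beta>" 1] beta dj by simp
        have 3: "dist j y \<le> dist j h + dist h y" by (rule dist_triangle)
        have 4: "dist j h \<le> d j / 10" using j by simp
        have 5: "d y \<le> d j + dist j y" using lip[of j y] by simp
        have 6: "M * d j powr (1 / \<beta>) = 2 * M0 * d j powr (1 / \<beta>) + 2 * (D powr (1 - 1 / \<beta>) * d j powr (1 / \<beta>))"
          by (simp add: M_def algebra_simps)
        have "dist j y \<le> M * d j powr (1 / \<beta>)" "d y \<le> M * d j powr (1 / \<beta>)"
          unfolding 6 using 1 2 3 4 5 h(2) dj by linarith+
        then show ?thesis using j y by (auto simp: S_def)
      qed
    qed
    have "emeasure wmeas E = emeasure wmeas (E \<inter> \<Omega>)"
      by (simp add: wmeas_def emeasure_density) (auto intro!: nn_integral_cong simp: indicator_def)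
    also have "\<dots> \<le> emeasure wmeas ((\<Union>i\<in>C. A i) \<union> (\<Union>j\<in>C'. S j))"
      using C C' cov by (intro emeasure_mono) (auto simp: sets_wmeas intro!: sets.countable_UN')
    also have "\<dots> \<le> emeasure wmeas (\<Union>i\<in>C. A i) + emeasure wmeas (\<Union>j\<in>C'. S j)"
      using C C' by (intro emeasure_subadditive) (auto simp: sets_wmeas intro!: sets.countable_UN')
    also have "\<dots> \<le> ennreal ((k1 * (N * P)) powr q) + ennreal ((k2 * (N * P)) powr q)"
      by (intro add_mono low high)
    also have "\<dots> = ennreal ((k1 * (N * P)) powr q + (k2 * (N * P)) powr q)"
      by (simp add: ennreal_plus)
    also have "\<dots> \<le> ennreal ((k * P) powr q)"
    proof (rule ennreal_leI)
      define U where "U = k1 * (N * P) + k2 * (N * P)"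
      have nn: "0 \<le> k1 * (N * P)" "0 \<le> k2 * (N * P)" using k1 k2 N real by auto
      have "(k1 * (N * P)) powr q + (k2 * (N * P)) powr q \<le> 2 * U powr q"
        using nn q powr_mono2[of q "k1 * (N * P)" U] powr_mono2[of q "k2 * (N * P)" U] by (simp add: U_def)
      also have "\<dots> \<le> 2 powr q * U powr q"
        using powr_mono[of 1 q 2] q by (intro mult_right_mono) auto
      also have "\<dots> = (2 * U) powr q" using nn by (subst powr_mult) (simp_all add: U_def)
      also have "\<dots> \<le> (k * P) powr q"
        using nn q real by (intro powr_mono2) (auto simp: U_def k_def algebra_simps)
      finally show "(k1 * (N * P)) powr q + (k2 * (N * P)) powr q \<le> (k * P) powr q" .
    qed
    finally have "measure wmeas E \<le> (k * P) powr q"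
      by (simp add: emeasure_eq_measure)
    then have "measure wmeas E powr (1 / q) \<le> ((k * P) powr q) powr (1 / q)"
      using q by (intro powr_mono2) auto
    also have "\<dots> = k * P" using q k real by (simp add: powr_powr)
    finally show ?thesis using real k by (simp add: ennreal_mult[symmetric] ennreal_leI)
  qed
  then show thesis using that k by blast
qed

section \<open>Passage from level sets to functions\<close>

definition energy :: "('a \<Rightarrow> real) \<Rightarrow> ennreal" where
  "energy F = (\<integral>\<^sup>+x\<in>\<Omega>. (\<integral>\<^sup>+z\<in>\<Omega>. kern x z * ennreal \<bar>F z - F x\<bar> \<partial>lborel) \<partial>lborel)"

definition level_integrand :: "('a \<Rightarrow> real) \<Rightarrow> real \<Rightarrow> 'a \<times> 'a \<Rightarrow> ennreal" where
  "level_integrand F t w = kern (fst w) (snd w) * indicator \<Omega> (snd w) * indicator \<Omega> (fst w)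
    * (if F (snd w) \<le> t \<and> t < F (fst w) then 1 else 0)"

lemma kern_pair_measurable [measurable]:
  "(\<lambda>w. kern (fst w) (snd w)) \<in> borel_measurable (borel :: ('a \<times> 'a) measure)"
  using kern_measurable by (simp add: case_prod_beta' borel_prod)

lemma fst_snd_borel [measurable]:
  "fst \<in> borel_measurable (borel :: ('a \<times> 'a) measure)"
  "snd \<in> borel_measurable (borel :: ('a \<times> 'a) measure)"
  by (auto simp: borel_prod[symmetric])

lemma level_integrand_measurable:
  fixes F :: "'a \<Rightarrow> real"
  assumes [measurable]: "F \<in> borel_measurable borel"
  shows "case_prod (level_integrand F) \<in> borel_measurable (borel \<Otimes>\<^sub>M borel)"
  unfolding level_integrand_def case_prod_beta' by measurable

text \<open>Writing the crossing energy as a single integral over pairs of points makes it measurable in the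
level and lets Tonelli exchange it with the integral over levels.\<close>

lemma crossing_level_eq:
  fixes F :: "'a \<Rightarrow> real"
  assumes F: "F \<in> borel_measurable borel"
  shows "crossing kern ({x. t < F x} \<inter> \<Omega>) (\<Omega> - {x. t < F x}) = (\<integral>\<^sup>+w. level_integrand F t w \<partial>lborel)"
proof -
  have "crossing kern ({x. t < F x} \<inter> \<Omega>) (\<Omega> - {x. t < F x}) = (\<integral>\<^sup>+x. (\<integral>\<^sup>+z. level_integrand F t (x, z) \<partial>lborel) \<partial>lborel)"
    unfolding crossing_def
  proof (rule nn_integral_cong)
    fix x
    show "(\<integral>\<^sup>+z\<in>\<Omega> - {x. t < F x}. kern x z \<partial>lborel) * indicator ({x. t < F x} \<inter> \<Omega>) x = (\<integral>\<^sup>+z. level_integrand F t (x, z) \<partial>lborel)"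
      by (cases "x \<in> {x. t < F x} \<inter> \<Omega>") (auto simp: level_integrand_def indicator_def intro!: nn_integral_cong)
  qed
  also have "\<dots> = (\<integral>\<^sup>+w. level_integrand F t w \<partial>lborel)"
  proof -
    have "level_integrand F t \<in> borel_measurable borel"
      using measurable_Pair2[OF level_integrand_measurable[OF F], of t] by simp
    then show ?thesis
      using lborel.nn_integral_fst[of "level_integrand F t" lborel] by (simp add: lborel_prod)
  qed
  finally show ?thesis .
qed

lemma crossing_level_measurable:
  fixes F :: "'a \<Rightarrow> real"
  assumes F: "F \<in> borel_measurable borel"
  shows "(\<lambda>t. crossing kern ({x. t < F x} \<inter> \<Omega>) (\<Omega> - {x. t < F x})) \<in> borel_measurable borel"
  unfolding crossing_level_eq[OF F] using level_integrand_measurable[OF F]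
  by (intro lborel.borel_measurable_nn_integral) simp

text \<open>After exchanging the integrals this is the fact that the levels \<open>t\<close> with \<open>F z \<le> t < F x\<close> form an interval
of length at most \<open>\<bar>F z - F x\<bar>\<close>.\<close>

lemma coarea_inequality:
  fixes F :: "'a \<Rightarrow> real"
  assumes F[measurable]: "F \<in> borel_measurable borel"
  shows "(\<integral>\<^sup>+t. crossing kern ({x. t < F x} \<inter> \<Omega>) (\<Omega> - {x. t < F x}) \<partial>lborel) \<le> energy F"
proof -
  let ?h = "level_integrand F"
  have "(\<integral>\<^sup>+t. crossing kern ({x. t < F x} \<inter> \<Omega>) (\<Omega> - {x. t < F x}) \<partial>lborel)
      = (\<integral>\<^sup>+t. (\<integral>\<^sup>+w. ?h t w \<partial>lborel) \<partial>lborel)"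
    by (simp add: crossing_level_eq[OF F])
  also have "\<dots> = (\<integral>\<^sup>+w. (\<integral>\<^sup>+t. ?h t w \<partial>lborel) \<partial>lborel)"
    by (rule lborel_pair.Fubini'[symmetric]) (use level_integrand_measurable[OF F] in simp)
  also have "\<dots> \<le> (\<integral>\<^sup>+w. kern (fst w) (snd w) * indicator \<Omega> (snd w) * indicator \<Omega> (fst w) * ennreal \<bar>F (snd w) - F (fst w)\<bar> \<partial>lborel)"
  proof (rule nn_integral_mono)
    fix w
    have "(\<integral>\<^sup>+t. ?h t w \<partial>lborel) = (\<integral>\<^sup>+t. kern (fst w) (snd w) * indicator \<Omega> (snd w) * indicator \<Omega> (fst w)
      * indicator {F (snd w)..<F (fst w)} t \<partial>lborel)"
      by (intro nn_integral_cong) (auto simp: level_integrand_def indicator_def)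
    also have "\<dots> = kern (fst w) (snd w) * indicator \<Omega> (snd w) * indicator \<Omega> (fst w) * emeasure lborel {F (snd w)..<F (fst w)}"
      by (rule nn_integral_cmult_indicator) simp
    also have "emeasure lborel {F (snd w)..<F (fst w)} \<le> ennreal \<bar>F (snd w) - F (fst w)\<bar>"
      by (cases "F (snd w) \<le> F (fst w)") (auto intro!: ennreal_leI)
    finally show "(\<integral>\<^sup>+t. ?h t w \<partial>lborel) \<le> kern (fst w) (snd w) * indicator \<Omega> (snd w) * indicator \<Omega> (fst w) * ennreal \<bar>F (snd w) - F (fst w)\<bar>"
      by (simp add: mult_left_mono)
  qed
  also have "\<dots> = (\<integral>\<^sup>+x. (\<integral>\<^sup>+z. kern x z * indicator \<Omega> z * indicator \<Omega> x * ennreal \<bar>F z - F x\<bar> \<partial>lborel) \<partial>lborel)"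
    by (subst lborel_prod[symmetric], subst lborel.nn_integral_fst[symmetric]) auto
  also have "\<dots> = energy F"
    unfolding energy_def
  proof (rule nn_integral_cong)
    fix x
    show "(\<integral>\<^sup>+z. kern x z * indicator \<Omega> z * indicator \<Omega> x * ennreal \<bar>F z - F x\<bar> \<partial>lborel)
      = (\<integral>\<^sup>+z\<in>\<Omega>. kern x z * ennreal \<bar>F z - F x\<bar> \<partial>lborel) * indicator \<Omega> x"
      by (cases "x \<in> \<Omega>") (auto simp: indicator_def intro!: nn_integral_cong)
  qed
  finally show ?thesis .
qed

text \<open>For \<open>t > 0\<close> the level set \<open>{F > t}\<close> inherits from \<open>{F > 0}\<close> that it fills at most half of the central ball, so
the inequality for sets applies at every such level and can be integrated over \<open>t\<close>.\<close>

lemma positive_part_inequality: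
  obtains k where "0 < k"
    "\<And>F J. F \<in> borel_measurable borel \<Longrightarrow> 2 * vol ({x. 0 < F x} \<inter> wball 0) \<le> vol (wball 0) \<Longrightarrow>
       0 \<le> J \<Longrightarrow> energy F \<le> ennreal J \<Longrightarrow>
       (\<integral>\<^sup>+y. ennreal (max 0 (F y) powr q) \<partial>wmeas) \<le> ennreal (q * (k * J) powr q)"
proof -
  obtain k where k: "0 < k" "\<And>E. E \<in> sets borel \<Longrightarrow> 2 * vol (E \<inter> wball 0) \<le> vol (wball 0) \<Longrightarrow>
      ennreal (measure wmeas E powr (1 / q)) \<le> ennreal k * crossing kern (E \<inter> \<Omega>) (\<Omega> - E)"
    using level_set_inequality by blast
  have "(\<integral>\<^sup>+y. ennreal (max 0 (F y) powr q) \<partial>wmeas) \<le> ennreal (q * (k * J) powr q)"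
    if F[measurable]: "F \<in> borel_measurable borel" and half: "2 * vol ({x. 0 < F x} \<inter> wball 0) \<le> vol (wball 0)"
      and J: "0 \<le> J" "energy F \<le> ennreal J" for F J
  proof (rule nn_integral_powr_le_level_sets[OF finite_wmeas])
    have lev[measurable]: "{x. t < F x} \<in> sets borel" for t
    proof -
      have "{x \<in> space borel. t < F x} \<in> sets borel" by measurable
      then show ?thesis by simp
    qed
    have "(\<integral>\<^sup>+t. ennreal (measure wmeas {x \<in> space wmeas. t < max 0 (F x)} powr (1 / q)) * indicator {0<..} t \<partial>lborel)
      \<le> (\<integral>\<^sup>+t. ennreal k * crossing kern ({x. t < F x} \<inter> \<Omega>) (\<Omega> - {x. t < F x}) \<partial>lborel)"
    proof (rule nn_integral_mono)
      fix t :: real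
      show "ennreal (measure wmeas {x \<in> space wmeas. t < max 0 (F x)} powr (1 / q)) * indicator {0<..} t
        \<le> ennreal k * crossing kern ({x. t < F x} \<inter> \<Omega>) (\<Omega> - {x. t < F x})"
      proof (cases "0 < t")
        case True
        then have "{x \<in> space wmeas. t < max 0 (F x)} = {x. t < F x}" by auto
        moreover have "vol ({x. t < F x} \<inter> wball 0) \<le> vol ({x. 0 < F x} \<inter> wball 0)"
          using True by (intro measure_mono_fmeasurable Int_ball_fmeasurable lev) auto
        ultimately show ?thesis using k(2)[of "{x. t < F x}"] half True by simp
      qed simp
    qed
    also have "\<dots> \<le> ennreal k * energy F"
    proof -
      have "(\<integral>\<^sup>+t. ennreal k * crossing kern ({x. t < F x} \<inter> \<Omega>) (\<Omega> - {x. t < F x}) \<partial>lborel)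
        = ennreal k * (\<integral>\<^sup>+t. crossing kern ({x. t < F x} \<inter> \<Omega>) (\<Omega> - {x. t < F x}) \<partial>lborel)"
        by (rule nn_integral_cmult) (simp add: crossing_level_measurable[OF F])
      then show ?thesis using coarea_inequality[OF F] by (simp add: mult_left_mono)
    qed
    also have "\<dots> \<le> ennreal k * ennreal J" using J by (intro mult_left_mono) auto
    also have "\<dots> = ennreal (k * J)" using k J by (simp add: ennreal_mult)
    finally show "(\<integral>\<^sup>+t. ennreal (measure wmeas {x \<in> space wmeas. t < max 0 (F x)} powr (1 / q)) * indicator {0<..} t \<partial>lborel)
      \<le> ennreal (k * J)" .
  qed (use q k J in auto)
  then show thesis using that k by blast
qed

text \<open>Subtracting a median on the central ball makes the positive part and the negative part satisfy the density
condition at once, and neither subtraction nor reflection changes the energy.\<close>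

lemma oscillation_inequality:
  obtains C where "0 < C" "\<And>f. continuous_on \<Omega> f \<Longrightarrow>
    (INF c. ennreal_powr (\<integral>\<^sup>+y\<in>\<Omega>. ennreal (\<bar>f y - c\<bar> powr q * d y powr a) \<partial>lborel) (1 / q))
      \<le> ennreal C * (\<integral>\<^sup>+x\<in>\<Omega>. (\<integral>\<^sup>+z\<in>{z. norm (x - z) \<le> d x / 2}.
             ennreal (\<bar>f z - f x\<bar> / norm (z - x) powr (DIM('a) + s) * min (d x) (d z) powr b)
             \<partial>lborel) \<partial>lborel)"
proof -
  obtain k where k: "0 < k" and pos: "\<And>F J. F \<in> borel_measurable borel \<Longrightarrow>
       2 * vol ({x. 0 < F x} \<inter> wball 0) \<le> vol (wball 0) \<Longrightarrow> 0 \<le> J \<Longrightarrow> energy F \<le> ennreal J \<Longrightarrow>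
       (\<integral>\<^sup>+y. ennreal (max 0 (F y) powr q) \<partial>wmeas) \<le> ennreal (q * (k * J) powr q)"
    using positive_part_inequality by blast
  define C where "C = (2 * q) powr (1 / q) * k"
  have C: "0 < C" using k q by (simp add: C_def)
  have "(INF c. ennreal_powr (\<integral>\<^sup>+y\<in>\<Omega>. ennreal (\<bar>f y - c\<bar> powr q * d y powr a) \<partial>lborel) (1 / q))
      \<le> ennreal C * (\<integral>\<^sup>+x\<in>\<Omega>. (\<integral>\<^sup>+z\<in>{z. norm (x - z) \<le> d x / 2}.
             ennreal (\<bar>f z - f x\<bar> / norm (z - x) powr (DIM('a) + s) * min (d x) (d z) powr b)
             \<partial>lborel) \<partial>lborel)" (is "?L \<le> ennreal C * ?R")
    if f: "continuous_on \<Omega> f" for f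
  proof (cases "?R")
    case top
    then show ?thesis using C by (simp add: ennreal_mult_top)
  next
    case (real J)
    \<comment> \<open>\<open>f\<close> is arbitrary outside \<open>\<Omega>\<close>; cutting it off makes it Borel measurable on the whole space.\<close>
    define F where "F x = indicator \<Omega> x *\<^sub>R f x" for x
    have F[measurable]: "F \<in> borel_measurable borel"
      unfolding F_def by (rule borel_measurable_continuous_on_indicator[OF borel_domain f])
    have Ff: "F x = f x" if "x \<in> \<Omega>" for x using that by (simp add: F_def)
    have "energy F \<le> ?R"
      unfolding energy_def
    proof (rule nn_integral_mono)
      fix x
      show "(\<integral>\<^sup>+z\<in>\<Omega>. kern x z * ennreal \<bar>F z - F x\<bar> \<partial>lborel) * indicator \<Omega> x
        \<le> (\<integral>\<^sup>+z\<in>{z. norm (x - z) \<le> d x / 2}.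
             ennreal (\<bar>f z - f x\<bar> / norm (z - x) powr (DIM('a) + s) * min (d x) (d z) powr b) \<partial>lborel) * indicator \<Omega> x"
      proof (cases "x \<in> \<Omega>")
        case True
        have "kern x z * ennreal \<bar>F z - F x\<bar> * indicator \<Omega> z
          \<le> ennreal (\<bar>f z - f x\<bar> / norm (z - x) powr (DIM('a) + s) * min (d x) (d z) powr b) * indicator {z. norm (x - z) \<le> d x / 2} z" for z
          using True by (cases "z \<in> \<Omega>") (auto simp: kern_def Ff ennreal_mult[symmetric] mult.commute)
        then show ?thesis by (intro mult_right_mono nn_integral_mono) auto
      qed simp
    qed
    then have en: "energy F \<le> ennreal J" using real by simp
    have "wball 0 \<subseteq> cball 0 (d 0 / 10)" "cball 0 (d 0 / 10) \<subseteq> ball 0 (d 0)"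
      using d_pos[OF zero_mem] by auto
    then have sub: "wball 0 \<subseteq> cball 0 (d 0 / 10)" "cball 0 (d 0 / 10) \<subseteq> \<Omega>"
      using ball_subset_domain[OF zero_mem] by auto
    have "bounded (f ` cball 0 (d 0 / 10))"
      using sub by (intro compact_imp_bounded compact_continuous_image continuous_on_subset[OF f]) auto
    then obtain L where L: "\<And>x. x \<in> wball 0 \<Longrightarrow> \<bar>F x\<bar> \<le> L"
      using sub by (force simp: bounded_iff Ff subset_iff)
    obtain c where c: "2 * vol ({x. c < F x} \<inter> wball 0) \<le> vol (wball 0)" "2 * vol ({x. F x < c} \<inter> wball 0) \<le> vol (wball 0)"
      by (rule exists_median[OF F ball_fmeasurable[of 0 "d 0 / 10"] _ L]) (use d_pos[OF zero_mem] content_ball_pos[of "d 0 / 10" "0::'a"] in auto)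
    have "(\<integral>\<^sup>+y. ennreal (max 0 (F y - c) powr q) \<partial>wmeas) \<le> ennreal (q * (k * J) powr q)"
      using c en real by (intro pos) (auto simp: energy_def)
    moreover have "(\<integral>\<^sup>+y. ennreal (max 0 (c - F y) powr q) \<partial>wmeas) \<le> ennreal (q * (k * J) powr q)"
      using c en real by (intro pos) (auto simp: energy_def abs_minus_commute)
    ultimately have sum: "(\<integral>\<^sup>+y. ennreal (max 0 (F y - c) powr q) \<partial>wmeas) + (\<integral>\<^sup>+y. ennreal (max 0 (c - F y) powr q) \<partial>wmeas)
      \<le> ennreal (q * (k * J) powr q) + ennreal (q * (k * J) powr q)"
      by (rule add_mono)
    have "(\<integral>\<^sup>+y\<in>\<Omega>. ennreal (\<bar>f y - c\<bar> powr q * d y powr a) \<partial>lborel) = (\<integral>\<^sup>+y. ennreal (\<bar>F y - c\<bar> powr q) \<partial>wmeas)"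
    proof -
      have "(\<integral>\<^sup>+y. ennreal (\<bar>F y - c\<bar> powr q) \<partial>wmeas)
        = (\<integral>\<^sup>+y. ennreal (d y powr a) * indicator \<Omega> y * ennreal (\<bar>F y - c\<bar> powr q) \<partial>lborel)"
        unfolding wmeas_def by (rule nn_integral_density) auto
      also have "\<dots> = (\<integral>\<^sup>+y\<in>\<Omega>. ennreal (\<bar>f y - c\<bar> powr q * d y powr a) \<partial>lborel)"
        by (intro nn_integral_cong) (auto simp: indicator_def Ff ennreal_mult mult.commute)
      finally show ?thesis by simp
    qed
    also have "\<dots> \<le> (\<integral>\<^sup>+y. ennreal (max 0 (F y - c) powr q) + ennreal (max 0 (c - F y) powr q) \<partial>wmeas)"
      by (intro nn_integral_mono) (auto simp: abs_if max_def)
    also have "\<dots> = (\<integral>\<^sup>+y. ennreal (max 0 (F y - c) powr q) \<partial>wmeas) + (\<integral>\<^sup>+y. ennreal (max 0 (c - F y) powr q) \<partial>wmeas)"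
      by (rule nn_integral_add) measurable
    also have "\<dots> \<le> ennreal (2 * q * (k * J) powr q)"
      using sum q by (simp add: ennreal_plus[symmetric] mult.assoc del: ennreal_plus)
    finally have "ennreal_powr (\<integral>\<^sup>+y\<in>\<Omega>. ennreal (\<bar>f y - c\<bar> powr q * d y powr a) \<partial>lborel) (1 / q)
      \<le> ennreal ((2 * q * (k * J) powr q) powr (1 / q))"
      using q by (intro ennreal_powr_le) auto
    also have "(2 * q * (k * J) powr q) powr (1 / q) = C * J"
      using q k real by (simp add: powr_mult powr_powr C_def)
    finally have "ennreal_powr (\<integral>\<^sup>+y\<in>\<Omega>. ennreal (\<bar>f y - c\<bar> powr q * d y powr a) \<partial>lborel) (1 / q) \<le> ennreal C * ?R"
      using real C by (simp add: ennreal_mult)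
    then show ?thesis by (rule INF_lower2[OF UNIV_I])
  qed
  then show thesis using that C by blast
qed

end

lemma bdist_ball_subset:
  fixes \<Omega> :: "'a::euclidean_space set"
  assumes "x \<in> \<Omega>"
  shows "ball x (bdist \<Omega> x) \<subseteq> \<Omega>"
proof (rule ccontr)
  assume "\<not> ?thesis"
  then obtain y where y: "y \<in> ball x (bdist \<Omega> x) - \<Omega>" by blast
  then have "0 < bdist \<Omega> x" using zero_le_dist[of x y] by (auto simp del: zero_le_dist)
  then have xi: "x \<in> ball x (bdist \<Omega> x) \<inter> \<Omega>" using assms by simp
  then have "ball x (bdist \<Omega> x) \<inter> frontier \<Omega> \<noteq> {}"
    using y xi by (intro connected_Int_frontier connected_ball) blast+
  then obtain p where "p \<in> ball x (bdist \<Omega> x)" "p \<in> frontier \<Omega>" by auto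
  then show False using infdist_le[of p "frontier \<Omega>" x] by (simp add: bdist_def)
qed

text \<open>Each \<open>K\<close>-Lipschitz John curve is within \<open>K * t\<close> of its starting point at time \<open>t\<close>.
The boundary is nonempty because a bounded open set is not closed unless it is empty, so the distance to it is
positive in \<open>\<Omega>\<close>.\<close>

lemma fractional_john_of_john_domain:
  fixes \<Omega> :: "'a::euclidean_space set"
    and \<beta> s q a b :: real
  assumes "john_domain \<beta> \<Omega>" "1 \<le> \<beta>" "0 < s" "s < 1" "1 \<le> q" "q \<le> DIM('a) / (DIM('a) - s)" "0 \<le> a"
    "b \<le> (DIM('a) + a) / (q * \<beta>) + s - DIM('a)"
  obtains D l K where "fractional_john \<Omega> (bdist \<Omega>) D l K \<beta> s q a b"
proof -
  have \<Omega>: "open \<Omega>" "bounded \<Omega>" "0 \<in> \<Omega>" using assms(1) by (auto simp: john_domain_def)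
  obtain \<gamma> :: "real \<Rightarrow> 'a \<Rightarrow> 'a" and l K where "0 < l" "0 < K"
    and \<gamma>: "\<forall>y\<in>\<Omega>. rectifiable (\<lambda>t. \<gamma> t y) \<and> (\<forall>t\<in>{0..1}. \<gamma> t y \<in> \<Omega>)"
      "\<forall>y\<in>\<Omega>. \<gamma> 0 y = y \<and> \<gamma> 1 y = 0"
      "\<forall>y\<in>\<Omega>. \<forall>t\<in>{0..1}. bdist \<Omega> (\<gamma> t y) \<ge> l * t powr \<beta>"
      "\<forall>y\<in>\<Omega>. speed_bounded K (\<lambda>t. \<gamma> t y)"
    using assms(1) unfolding john_domain_def by (elim conjE exE) (rule that)
  have "\<Omega> \<noteq> UNIV" using \<Omega> not_bounded_UNIV by auto
  then have fr: "frontier \<Omega> \<noteq> {}" using \<Omega> frontier_eq_empty by auto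
  have bcl: "bounded (closure \<Omega>)" using \<Omega> by (intro bounded_closure)
  have "fractional_john \<Omega> (bdist \<Omega>) (diameter (closure \<Omega>)) l K \<beta> s q a b"
  proof
    show "\<bar>bdist \<Omega> x - bdist \<Omega> y\<bar> \<le> dist x y" for x y
      unfolding bdist_def by (rule infdist_triangle_abs)
    show "0 \<le> bdist \<Omega> x" for x by (simp add: bdist_def infdist_nonneg)
    show "0 < bdist \<Omega> x" if "x \<in> \<Omega>" for x
      unfolding bdist_def using that fr \<Omega> by (intro infdist_pos_not_in_closed) (auto simp: frontier_def interior_open)
    show "bdist \<Omega> x \<le> diameter (closure \<Omega>)" if "x \<in> \<Omega>" for x
    proof -
      obtain p where p: "p \<in> frontier \<Omega>" using fr by auto
      have "bdist \<Omega> x \<le> dist x p" unfolding bdist_def by (rule infdist_le[OF p])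
      also have "\<dots> \<le> diameter (closure \<Omega>)"
        using that p closure_subset[of \<Omega>] by (intro diameter_bounded_bound[OF bcl]) (auto simp: frontier_def)
      finally show ?thesis .
    qed
    show "ball x (bdist \<Omega> x) \<subseteq> \<Omega>" if "x \<in> \<Omega>" for x using that by (rule bdist_ball_subset)
    show "\<exists>g. continuous_on {0..1} g \<and> g 0 = y \<and> g 1 = 0 \<and>
        (\<forall>t\<in>{0..1}. g t \<in> \<Omega> \<and> l * t powr \<beta> \<le> bdist \<Omega> (g t) \<and> dist y (g t) \<le> K * t)" if y: "y \<in> \<Omega>" for y
    proof (intro exI conjI ballI)
      show "continuous_on {0..1} (\<lambda>t. \<gamma> t y)" using \<gamma>(1) y by (auto simp: rectifiable_def)
      have "K-lipschitz_on {0..1} (\<lambda>t. \<gamma> t y)" using \<gamma>(4) y by (auto simp: speed_bounded_def)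
      then have "dist (\<gamma> 0 y) (\<gamma> t y) \<le> K * dist 0 t" if "t \<in> {0..1}" for t
        using that by (intro lipschitz_onD) auto
      moreover have "\<gamma> 0 y = y" using \<gamma>(2) y by blast
      ultimately show "dist y (\<gamma> t y) \<le> K * t" if "t \<in> {0..1}" for t
        using that by auto
    qed (use \<gamma> y in auto)
  qed (use assms \<Omega> \<open>0 < l\<close> \<open>0 < K\<close> in auto)
  then show thesis by (rule that)
qed

theorem theorem4p2:
  fixes \<Omega> :: "(real ^ 'n) set" and \<beta> s q a b :: real
  assumes "CARD('n) \<ge> 2" and "\<beta> \<ge> 1" and "john_domain \<beta> \<Omega>"
    and "0 < s" and "s < 1"
    and "1 \<le> q" and "q \<le> real CARD('n) / (real CARD('n) - s)"
    and "a \<ge> 0"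
    and "b \<le> (real CARD('n) + a) / (q * \<beta>) + s - real CARD('n)"
  shows "\<exists>C::real. C > 0 \<and>
    (\<forall>f :: real ^ 'n \<Rightarrow> real. smooth_on \<Omega> f \<longrightarrow>
      (INF c::real. weighted_norm q a \<Omega> (\<lambda>y. f y - c))
        \<le> ennreal C *
          (\<integral>\<^sup>+x\<in>\<Omega>. (\<integral>\<^sup>+z\<in>{z. norm (x - z) \<le> bdist \<Omega> x / 2}.
             ennreal (\<bar>f z - f x\<bar> / norm (z - x) powr (real CARD('n) + s) * bdist2 \<Omega> x z powr b)
             \<partial>lborel) \<partial>lborel))"
proof -
  obtain D l K where "fractional_john \<Omega> (bdist \<Omega>) D l K \<beta> s q a b"
    by (rule fractional_john_of_john_domain[of \<beta> \<Omega> s q a b]) (use assms in auto)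
  then interpret fractional_john \<Omega> "bdist \<Omega>" D l K \<beta> s q a b .
  obtain C where C: "0 < C" "\<And>f. continuous_on \<Omega> f \<Longrightarrow>
    (INF c. ennreal_powr (\<integral>\<^sup>+y\<in>\<Omega>. ennreal (\<bar>f y - c\<bar> powr q * bdist \<Omega> y powr a) \<partial>lborel) (1 / q))
      \<le> ennreal C * (\<integral>\<^sup>+x\<in>\<Omega>. (\<integral>\<^sup>+z\<in>{z. norm (x - z) \<le> bdist \<Omega> x / 2}.
             ennreal (\<bar>f z - f x\<bar> / norm (z - x) powr (real DIM(real ^ 'n) + s) * min (bdist \<Omega> x) (bdist \<Omega> z) powr b)
             \<partial>lborel) \<partial>lborel)"
    by (rule oscillation_inequality) (rule that)
  have "continuous_on \<Omega> f" if "smooth_on \<Omega> f" for f :: "real ^ 'n \<Rightarrow> real"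
    using that Ck_on.simps(1)[of \<Omega> f] unfolding smooth_on_def by blast
  then show ?thesis
    using C by (intro exI[of _ C]) (simp add: weighted_norm_def bdist2_def)
qed

end
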